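(* If $(X,d)$ is a proper CAT(0) space which is homeomorphic to $\mathbb{R}^2$, then $\operatorname{asdim}(X,d)=2$.
   Context: A metric space is proper if all its closed bounded subsets are compact. A geodesic space is a metric space in which any two points $x,y$ are joined by a geodesic, i.e. an isometric embedding $\xi:[0,d(x,y)]\to X$ with $\xi(0)=x$, $\xi(d(x,y))=y$. A CAT(0) space is a geodesic space $X$ such that for every geodesic triangle $T$ in $X$, every comparison triangle $\overline{T}$ in the Euclidean plane (a triangle with the same edge lengths), and all points $x,y\in T$ with corresponding points $\bar x,\bar y\in\overline{T}$, one has $d(x,y)\le d_{\mathbb{R}^2}(\bar x,\bar y)$. Asymptotic dimension: a family $\mathscr{U}$ of subsets of a metric space $(X,d)$ is uniformly bounded if there is $K>0$ with $\operatorname{diam} U\le K$ for all $U\in\mathscr{U}$; it is $r$-disjoint if $d(U,U')>r$ for all $U,U'\in\mathscr{U}$ with $U\ne U'$, where $d(U,U')=\inf\{d(u,u'):u\in U,u'\in U'\}$. One writes $\operatorname{asdim}(X,d)\le n$ if for every $r>0$ there exist uniformly bounded, $r$-disjoint families $\mathscr{U}^0,\dots,\mathscr{U}^n$ of subsets of $X$ such that $\bigcup_{k=0}^n\mathscr{U}^k$ covers $X$. One writes $\operatorname{asdim}(X,d)=n$ if $\operatorname{asdim}(X,d)\le n$ and not $\operatorname{asdim}(X,d)\le n-1$. *)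

theory Defs
  imports "HOL-Analysis.Analysis"
begin

definition proper_metric_space :: "'a set \<Rightarrow> ('a \<Rightarrow> 'a \<Rightarrow> real) \<Rightarrow> bool" where
  "proper_metric_space M d \<longleftrightarrow>
     (\<forall>S. closedin (Metric_space.mtopology M d) S \<and> Metric_space.mbounded M d S
        \<longrightarrow> compactin (Metric_space.mtopology M d) S)"


section \<open>Geodesics and CAT(0) spaces\<close>

text \<open>A geodesic is a function on all of \<open>\<real>\<close> of which only the restriction to
  \<open>[0, d x y]\<close> matters.\<close>

definition geodesic_between ::
  "'a set \<Rightarrow> ('a \<Rightarrow> 'a \<Rightarrow> real) \<Rightarrow> 'a \<Rightarrow> 'a \<Rightarrow> (real \<Rightarrow> 'a) \<Rightarrow> bool" where
  "geodesic_between M d x y \<xi> \<longleftrightarrow>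
     \<xi> ` {0..d x y} \<subseteq> M \<and>
     (\<forall>s\<in>{0..d x y}. \<forall>t\<in>{0..d x y}. d (\<xi> s) (\<xi> t) = \<bar>s - t\<bar>) \<and>
     \<xi> 0 = x \<and> \<xi> (d x y) = y"

definition geodesic_space :: "'a set \<Rightarrow> ('a \<Rightarrow> 'a \<Rightarrow> real) \<Rightarrow> bool" where
  "geodesic_space M d \<longleftrightarrow> (\<forall>x\<in>M. \<forall>y\<in>M. \<exists>\<xi>. geodesic_between M d x y \<xi>)"

text \<open>Vertices \<open>p\<close>, \<open>q\<close>, \<open>r\<close>, with sides \<open>\<alpha>\<close> from \<open>p\<close> to \<open>q\<close>, \<open>\<beta>\<close> from \<open>q\<close> to \<open>r\<close>
  and \<open>\<gamma>\<close> from \<open>r\<close> to \<open>p\<close>. Degenerate triangles are allowed.\<close>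

definition geodesic_triangle ::
  "'a set \<Rightarrow> ('a \<Rightarrow> 'a \<Rightarrow> real) \<Rightarrow> 'a \<Rightarrow> 'a \<Rightarrow> 'a \<Rightarrow>
     (real \<Rightarrow> 'a) \<Rightarrow> (real \<Rightarrow> 'a) \<Rightarrow> (real \<Rightarrow> 'a) \<Rightarrow> bool" where
  "geodesic_triangle M d p q r \<alpha> \<beta> \<gamma> \<longleftrightarrow>
     p \<in> M \<and> q \<in> M \<and> r \<in> M \<and>
     geodesic_between M d p q \<alpha> \<and> geodesic_between M d q r \<beta> \<and> geodesic_between M d r p \<gamma>"

definition comparison_triangle ::
  "('a \<Rightarrow> 'a \<Rightarrow> real) \<Rightarrow> 'a \<Rightarrow> 'a \<Rightarrow> 'a \<Rightarrow> real^2 \<Rightarrow> real^2 \<Rightarrow> real^2 \<Rightarrow> bool" where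
  "comparison_triangle d p q r p' q' r' \<longleftrightarrow>
     dist p' q' = d p q \<and> dist q' r' = d q r \<and> dist r' p' = d r p"

text \<open>\<open>x'\<close> is the point of the segment \<open>[p', q']\<close> corresponding to the point \<open>x\<close> of the
  side \<open>\<xi>\<close> from \<open>p\<close> to \<open>q\<close>.\<close>

definition side_corresponds ::
  "('a \<Rightarrow> 'a \<Rightarrow> real) \<Rightarrow> 'a \<Rightarrow> 'a \<Rightarrow> (real \<Rightarrow> 'a) \<Rightarrow> real^2 \<Rightarrow> real^2 \<Rightarrow> 'a \<Rightarrow> real^2 \<Rightarrow> bool" where
  "side_corresponds d p q \<xi> p' q' x x' \<longleftrightarrow>
     (\<exists>t\<in>{0..d p q}. x = \<xi> t \<and> x' \<in> closed_segment p' q' \<and> dist p' x' = t)"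

text \<open>This is a relation, not a function: a point lying on several sides may have several
  corresponding points, and the CAT(0) inequality is required for each of them.\<close>

definition triangle_corresponds ::
  "('a \<Rightarrow> 'a \<Rightarrow> real) \<Rightarrow> 'a \<Rightarrow> 'a \<Rightarrow> 'a \<Rightarrow>
     (real \<Rightarrow> 'a) \<Rightarrow> (real \<Rightarrow> 'a) \<Rightarrow> (real \<Rightarrow> 'a) \<Rightarrow>
     real^2 \<Rightarrow> real^2 \<Rightarrow> real^2 \<Rightarrow> 'a \<Rightarrow> real^2 \<Rightarrow> bool" where
  "triangle_corresponds d p q r \<alpha> \<beta> \<gamma> p' q' r' x x' \<longleftrightarrow>
     side_corresponds d p q \<alpha> p' q' x x' \<or>
     side_corresponds d q r \<beta> q' r' x x' \<or>
     side_corresponds d r p \<gamma> r' p' x x'"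

definition CAT0_space :: "'a set \<Rightarrow> ('a \<Rightarrow> 'a \<Rightarrow> real) \<Rightarrow> bool" where
  "CAT0_space M d \<longleftrightarrow>
     geodesic_space M d \<and>
     (\<forall>p q r \<alpha> \<beta> \<gamma> p' q' r'.
        geodesic_triangle M d p q r \<alpha> \<beta> \<gamma> \<and> comparison_triangle d p q r p' q' r' \<longrightarrow>
        (\<forall>x y x' y'.
           triangle_corresponds d p q r \<alpha> \<beta> \<gamma> p' q' r' x x' \<and>
           triangle_corresponds d p q r \<alpha> \<beta> \<gamma> p' q' r' y y' \<longrightarrow>
           d x y \<le> dist x' y'))"


section \<open>Asymptotic dimension\<close>

text \<open>Diameters and set distances take values in \<open>[0, \<infinity>]\<close>: an unbounded set has diameter
  \<open>\<infinity>\<close>, the empty set has diameter \<open>0\<close> and distance \<open>\<infinity>\<close> to every set.\<close>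

definition set_diam :: "('a \<Rightarrow> 'a \<Rightarrow> real) \<Rightarrow> 'a set \<Rightarrow> ennreal" where
  "set_diam d U = (SUP (u, v) \<in> U \<times> U. ennreal (d u v))"

definition set_distance :: "('a \<Rightarrow> 'a \<Rightarrow> real) \<Rightarrow> 'a set \<Rightarrow> 'a set \<Rightarrow> ennreal" where
  "set_distance d U V = (INF (u, v) \<in> U \<times> V. ennreal (d u v))"

definition uniformly_bounded_family :: "('a \<Rightarrow> 'a \<Rightarrow> real) \<Rightarrow> 'a set set \<Rightarrow> bool" where
  "uniformly_bounded_family d \<U> \<longleftrightarrow> (\<exists>K>0. \<forall>U\<in>\<U>. set_diam d U \<le> ennreal K)"

definition r_disjoint_family :: "('a \<Rightarrow> 'a \<Rightarrow> real) \<Rightarrow> real \<Rightarrow> 'a set set \<Rightarrow> bool" where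
  "r_disjoint_family d r \<U> \<longleftrightarrow>
     (\<forall>U\<in>\<U>. \<forall>V\<in>\<U>. U \<noteq> V \<longrightarrow> set_distance d U V > ennreal r)"

text \<open>The bound is an integer so that \<open>n - 1\<close> below is \<open>-1\<close>, not \<open>0\<close>, for \<open>n = 0\<close>.\<close>

definition asdim_le :: "'a set \<Rightarrow> ('a \<Rightarrow> 'a \<Rightarrow> real) \<Rightarrow> int \<Rightarrow> bool" where
  "asdim_le M d n \<longleftrightarrow>
     (\<forall>r>0. \<exists>\<U> :: int \<Rightarrow> 'a set set.
        (\<forall>k\<in>{0..n}. \<U> k \<subseteq> Pow M \<and> uniformly_bounded_family d (\<U> k) \<and>
                     r_disjoint_family d r (\<U> k)) \<and>
        M \<subseteq> (\<Union>k\<in>{0..n}. \<Union>(\<U> k)))"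

definition asdim_eq :: "'a set \<Rightarrow> ('a \<Rightarrow> 'a \<Rightarrow> real) \<Rightarrow> int \<Rightarrow> bool" where
  "asdim_eq M d n \<longleftrightarrow> asdim_le M d n \<and> \<not> asdim_le M d (n - 1)"

end

theory Submission
  imports Defs
begin

text \<open>Identify \<open>X\<close> with the complex plane carrying a second metric \<open>d\<close>. All topology is reduced to
  the fact that the identity of a circle around \<open>0\<close> has no continuous logarithm.

  Upper bound: three points of a metric sphere around \<open>0\<close>, prolonged to geodesics leaving a large
  ball, cut the plane into three sectors, so no point can be joined to each of them by a path
  avoiding the geodesics to the other two. If a geodesic between two points of the sphere crosses
  the radial geodesic of a third one, then the third point is close to the first two. Hence the
  spheres look coarsely like circles: uniformly in the radius, they split into two families of
  far apart bounded sets. Pulling these back along the radial projections gives such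
  families for annuli of fixed width, and annuli combine to three families.

  Lower bound: two families of disjoint bounded sets covering the plane yield a continuous map
  through a graph which moves points by a bounded distance and misses the point \<open>0\<close>. The geodesic
  homotopy from the identity to this map avoids \<open>0\<close> on a large circle, so the circle would be
  null-homotopic in the punctured plane.\<close>

section \<open>Continuous logarithms\<close>

text \<open>Geodesics may branch, and radial geodesics may share a piece near 0, so there are no
  polar coordinates and the cuts of the plane may overlap. What remains is that radial geodesics
  which have parted never meet again, because geodesics are unique; cuts through different points of
  a metric sphere are therefore disjoint beyond it. The side of a cut on which a point lies is read
  off from branches of the logarithm, in place of the Jordan curve theorem.

  The CAT(0) inequality enters through convexity of geodesics issuing from one point and through
  uniqueness of geodesics; the locale \<open>busemann_plane\<close> collects these facts. Asymptotic
  dimension is handled through chains: a set whose chains with steps at most r have bounded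
  displacement stands for the family of its coarse components.

  Separate color pairs for even and odd annuli would cost four colors. Letting neighboring annuli
  share a color saves one, at the price of unequal scales.\<close>

lemma inessential_iff_log:
  fixes f :: "'a::real_normed_vector \<Rightarrow> complex"
  shows "(\<exists>a. homotopic_with_canon (\<lambda>h. True) S (-{0}) f (\<lambda>t. a)) \<longleftrightarrow>
         (\<exists>g. continuous_on S g \<and> (\<forall>x\<in>S. exp (g x) = f x))"
  unfolding inessential_eq_continuous_logarithm by (simp add: eq_commute)

text \<open>A map into the punctured plane has a continuous logarithm iff it is null-homotopic
  there, and this property passes along homotopies avoiding 0. The direction from s = 1 back to s =
  0 suits all uses: the deformed map has an evident logarithm.\<close>

lemma continuous_logarithm_homotopy:
  fixes H :: "real \<Rightarrow> 'a::real_normed_vector \<Rightarrow> complex"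
  assumes cont: "continuous_on ({0..1} \<times> S) (\<lambda>(s, x). H s x)"
    and nz: "\<And>s x. \<lbrakk>0 \<le> s; s \<le> 1; x \<in> S\<rbrakk> \<Longrightarrow> H s x \<noteq> 0"
    and g: "continuous_on S g" "\<And>x. x \<in> S \<Longrightarrow> exp (g x) = H 1 x"
  obtains h where "continuous_on S h" "\<And>x. x \<in> S \<Longrightarrow> exp (h x) = H 0 x"
proof -
  have "homotopic_with_canon (\<lambda>h. True) S (-{0}) (H 0) (H 1)"
    unfolding homotopic_with_def
    using cont nz by (intro exI[of _ "\<lambda>(s, x). H s x"]) (auto simp: case_prod_unfold)
  moreover have "\<exists>a. homotopic_with_canon (\<lambda>h. True) S (-{0}) (H 1) (\<lambda>t. a)"
    unfolding inessential_iff_log using g by blast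
  ultimately have "\<exists>a. homotopic_with_canon (\<lambda>h. True) S (-{0}) (H 0) (\<lambda>t. a)"
    by (meson homotopic_with_trans)
  then show ?thesis
    unfolding inessential_iff_log using that by blast
qed

text \<open>Sliding x to 0 inside the disc reduces to the identity of the circle. A logarithm of it
  would give a zero-free extension to the disc; normalizing its values yields a retraction of the
  disc onto its boundary.\<close>

lemma no_continuous_logarithm_on_circle:
  fixes x :: complex
  assumes x: "norm x < R"
    and g: "continuous_on (sphere 0 R) g" "\<And>v. v \<in> sphere 0 R \<Longrightarrow> exp (g v) = v - x"
  shows False
proof -
  have R: "R > 0" using x norm_ge_zero[of x] by linarith
  have nz: "v - s *\<^sub>R x \<noteq> 0" if "0 \<le> s" "s \<le> 1" "v \<in> sphere 0 R" for s and v :: complex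
  proof
    assume "v - s *\<^sub>R x = 0"
    then have "norm v = s * norm x" using that by simp
    also have "\<dots> \<le> norm x" using that by (simp add: mult_left_le_one_le)
    finally show False using x that by simp
  qed
  obtain h where h: "continuous_on (sphere 0 R) h"
    "\<And>v. v \<in> sphere 0 R \<Longrightarrow> exp (h v) = v - 0 *\<^sub>R x"
    by (rule continuous_logarithm_homotopy[of "sphere 0 R" "\<lambda>s v. v - s *\<^sub>R x" g])
      (use g nz in \<open>auto simp: case_prod_unfold intro!: continuous_intros\<close>)
  have "exp (h v) = v" if "v \<in> sphere 0 R" for v
    using h(2)[OF that] by simp
  with h(1) have "\<exists>h :: complex \<Rightarrow> complex. continuous_on (sphere 0 R) h \<and> (\<forall>v\<in>sphere 0 R. exp (h v) = v)"
    by blast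
  then have "\<exists>a::complex. homotopic_with_canon (\<lambda>h. True) (sphere 0 R) (-{0}) (\<lambda>v. v) (\<lambda>t. a)"
    by (rule iffD2[OF inessential_iff_log])
  then have "\<exists>F. continuous_on (cball 0 R) F \<and> F ` cball 0 R \<subseteq> -{0::complex} \<and> (\<forall>v\<in>sphere 0 R. F v = v)"
    by (rule iffD1[OF nullhomotopic_from_sphere_extension])
  then obtain F where F: "continuous_on (cball 0 R) F" "F ` cball 0 R \<subseteq> -{0::complex}"
    "\<And>v. v \<in> sphere 0 R \<Longrightarrow> F v = v"
    by meson
  define r where "r = (\<lambda>v. (R / norm (F v)) *\<^sub>R F v)"
  have "retraction (cball 0 R) (sphere 0 R) r"
    unfolding retraction_def
  proof (intro conjI)
    show "continuous_on (cball 0 R) r"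
      unfolding r_def using F by (intro continuous_intros) auto
    show "r \<in> cball 0 R \<rightarrow> sphere 0 R"
      using F R by (auto simp: r_def)
    show "\<forall>x\<in>sphere 0 R. r x = x"
      using F R by (auto simp: r_def)
  qed auto
  then show False
    using no_retraction_cball[OF R, of "0::complex"] R by (auto simp: retract_of_def)
qed

text \<open>The difference of two logarithms of one function takes values in the multiples of 2 pi
  i, a discrete set, so it is constant on connected sets.\<close>

lemma continuous_logarithms_agree:
  fixes g1 g2 :: "complex \<Rightarrow> complex"
  assumes "connected Y" and cont: "continuous_on Y g1" "continuous_on Y g2"
    and eq: "\<And>p. p \<in> Y \<Longrightarrow> exp (g1 p) = exp (g2 p)"
    and q: "q \<in> Y" "g1 q = g2 q" and p: "p \<in> Y"
  shows "g1 p = g2 p"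
proof -
  have "(\<lambda>x. g1 x - g2 x) constant_on Y"
  proof (rule continuous_discrete_range_constant[OF \<open>connected Y\<close>])
    show "continuous_on Y (\<lambda>x. g1 x - g2 x)" using cont by (intro continuous_intros)
    fix x assume x: "x \<in> Y"
    show "\<exists>e>0. \<forall>y. y \<in> Y \<and> g1 y - g2 y \<noteq> g1 x - g2 x \<longrightarrow>
            e \<le> norm (g1 y - g2 y - (g1 x - g2 x))"
    proof (intro exI[of _ "2 * pi"] conjI allI impI)
      fix y assume y: "y \<in> Y \<and> g1 y - g2 y \<noteq> g1 x - g2 x"
      have "exp (g1 y - g2 y) = exp (g1 x - g2 x)"
        using eq x y by (simp add: exp_diff)
      then have "\<not> \<bar>Im (g1 y - g2 y) - Im (g1 x - g2 x)\<bar> < 2 * pi"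
        using y exp_complex_eqI by blast
      then show "2 * pi \<le> norm (g1 y - g2 y - (g1 x - g2 x))"
        using abs_Im_le_cmod[of "g1 y - g2 y - (g1 x - g2 x)"] by simp
    qed simp
  qed
  then show ?thesis using p q unfolding constant_on_def by (metis eq_iff_diff_eq_0)
qed

text \<open>Makes agreement of two branches a locally constant property: both agreement and
  disagreement spread over a ball, which is connected.\<close>

lemma continuous_logarithms_agree_locally:
  fixes g1 g2 :: "complex \<Rightarrow> complex"
  assumes "open W" and cont: "continuous_on W g1" "continuous_on W g2"
    and eq: "\<And>p. p \<in> W \<Longrightarrow> exp (g1 p) = exp (g2 p)" and p: "p \<in> W"
  obtains V where "open V" "p \<in> V" "V \<subseteq> W" "\<And>q. q \<in> V \<Longrightarrow> g1 q = g2 q \<longleftrightarrow> g1 p = g2 p"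
proof -
  obtain e where e: "e > 0" "ball p e \<subseteq> W" using assms by (meson open_contains_ball)
  have cont': "continuous_on (ball p e) g1" "continuous_on (ball p e) g2"
    using cont e continuous_on_subset by blast+
  have eq': "exp (g1 q) = exp (g2 q)" if "q \<in> ball p e" for q
    using eq e that by blast
  have iff: "g1 q = g2 q \<longleftrightarrow> g1 p = g2 p" if "q \<in> ball p e" for q
    using continuous_logarithms_agree[OF connected_ball cont' eq', of p q]
      continuous_logarithms_agree[OF connected_ball cont' eq', of q p] e that by auto
  show ?thesis by (rule that[OF open_ball _ e(2) iff]) (use e in simp_all)
qed

text \<open>Three cuts \<open>\<rho> i\<close> from the origin to the outside of \<open>U\<close> which are disjoint near the circle
  divide the plane into sectors, each bounded by two of the cuts, so no point can be joined to each
  of the three cuts without crossing the other two. To see this, choose logarithms on the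
  complements of the cuts which agree at \<open>z\<close>. Away from the hub the cuts are disjoint, and at each
  point of the circle at least two of the logarithms are defined and agree; their common value
  would be a logarithm on the whole circle.\<close>

lemma no_claw_across_three_cuts:
  fixes \<rho> \<tau> Z :: "nat \<Rightarrow> complex set" and L :: "nat \<Rightarrow> complex \<Rightarrow> complex"
  assumes U: "open U" "sphere 0 R \<subseteq> U" and R: "R > 0"
    and closed: "\<And>i. i < 3 \<Longrightarrow> closed (\<rho> i)"
    and contL: "\<And>i. i < 3 \<Longrightarrow> continuous_on (U - \<rho> i) (L i)"
    and expL: "\<And>i v. \<lbrakk>i < 3; v \<in> U - \<rho> i\<rbrakk> \<Longrightarrow> exp (L i v) = v"
    and conn\<tau>: "\<And>i. i < 3 \<Longrightarrow> connected (\<tau> i)"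
    and \<tau>U: "\<And>i. i < 3 \<Longrightarrow> \<tau> i \<subseteq> U"
    and \<tau>\<rho>: "\<And>i j. \<lbrakk>i < 3; j < 3; i \<noteq> j\<rbrakk> \<Longrightarrow> \<tau> i \<inter> \<rho> j = {}"
    and circ: "\<And>i. i < 3 \<Longrightarrow> sphere 0 R \<inter> \<rho> i \<subseteq> \<tau> i"
    and meets: "i0 < 3" "sphere 0 R \<inter> \<tau> i0 \<noteq> {}"
    and connZ: "\<And>i. i < 3 \<Longrightarrow> connected (Z i)"
    and ZU: "\<And>i. i < 3 \<Longrightarrow> Z i \<subseteq> U"
    and z: "\<And>i. i < 3 \<Longrightarrow> z \<in> Z i"
    and Z\<tau>: "\<And>i. i < 3 \<Longrightarrow> Z i \<inter> \<tau> i \<noteq> {}"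
    and Z\<rho>: "\<And>i j. \<lbrakk>i < 3; j < 3; i \<noteq> j\<rbrakk> \<Longrightarrow> Z i \<inter> \<rho> j = {}"
  shows False
proof -
  have less3: "i < 3 \<longleftrightarrow> i = 0 \<or> i = 1 \<or> i = 2" for i :: nat by auto
  have third: "\<exists>i<3. \<exists>j<3. i \<noteq> j \<and> i \<noteq> k \<and> j \<noteq> k" if "k < 3" for k :: nat
  proof -
    have "k = 0 \<or> k = 1 \<or> k = 2" using that by auto
    then show ?thesis
      by (elim disjE) (rule exI[of _ "if k = 0 then 1 else 0"], simp,
          rule exI[of _ "if k = 2 then 1 else 2"], simp)+
  qed
  \<comment> \<open>The center z lies off every cut: it belongs to a leg \<open>Z j\<close> with j
    different from i, and that leg avoids \<open>\<rho> i\<close>.\<close>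
  have zU: "z \<in> U - \<rho> i" if "i < 3" for i
  proof -
    obtain j where "j < 3" "j \<noteq> i" using third \<open>i < 3\<close> by blast
    then show ?thesis using Z\<rho>[of j i] z[of j] ZU[of j] that by blast
  qed
  define M where "M = (\<lambda>i v. L i v + (L 0 z - L i z))"
  have Mz: "M i z = L 0 z" for i by (simp add: M_def)
  have contM: "continuous_on (U - \<rho> i) (M i)" if "i < 3" for i
    unfolding M_def using contL[OF that] by (intro continuous_intros)
  have expM: "exp (M i v) = v" if "i < 3" "v \<in> U - \<rho> i" for i v
    using expL[OF that] expL[of i z] expL[of 0 z] zU that
    by (simp add: M_def exp_add exp_diff) (metis exp_not_eq_zero)
  define W where "W = (\<lambda>i j. U - \<rho> i - \<rho> j)"
  have openW: "open (W i j)" if "i < 3" "j < 3" for i j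
    using U closed that by (auto simp: W_def)
  have contW: "continuous_on (W i j) (M i)" "continuous_on (W i j) (M j)" if "i < 3" "j < 3" for i j
    by (rule continuous_on_subset[OF contM]; use that in \<open>auto simp: W_def\<close>)+
  have expW: "exp (M i p) = exp (M j p)" if "i < 3" "j < 3" "p \<in> W i j" for i j p
    using expM that by (auto simp: W_def)
  have loc: "\<exists>V. open V \<and> p \<in> V \<and> V \<subseteq> W i j \<and> (\<forall>q\<in>V. M i q = M j q \<longleftrightarrow> M i p = M j p)"
    if "i < 3" "j < 3" "p \<in> W i j" for i j p
    using continuous_logarithms_agree_locally[OF openW[OF that(1,2)] contW[OF that(1,2)]
        expW[OF that(1,2)] that(3)] by metis
  \<comment> \<open>The connected set \<open>Z k \<union> \<tau> k\<close> contains z and avoids the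
    other two cuts, so agreement of those two branches at z is carried out along leg k to the cut
    k.\<close>
  have agree\<tau>: "p \<in> W i j \<and> M i p = M j p"
    if "i < 3" "j < 3" "k < 3" "i \<noteq> k" "j \<noteq> k" "p \<in> \<tau> k" for i j k p
  proof -
    have sub: "Z k \<union> \<tau> k \<subseteq> W i j"
      using ZU \<tau>U Z\<rho>[of k i] Z\<rho>[of k j] \<tau>\<rho>[of k i] \<tau>\<rho>[of k j] that by (auto simp: W_def)
    have con: "connected (Z k \<union> \<tau> k)"
      by (rule connected_Un) (use connZ conn\<tau> Z\<tau> that in auto)
    have "M i p = M j p"
      by (rule continuous_logarithms_agree[OF con, where q = z])
        (use contW[of i j] sub that expW z Mz in \<open>auto intro: continuous_on_subset\<close>)
    then show ?thesis using sub that by blast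
  qed
  define Q where "Q = (\<lambda>p. \<exists>i<3. \<exists>j<3. i \<noteq> j \<and> p \<in> W i j \<and> M i p = M j p)"
  have Q\<tau>: "Q p" if "p \<in> \<tau> k" "k < 3" for p k
  proof -
    obtain i j where "i < 3" "j < 3" "i \<noteq> j" "i \<noteq> k" "j \<noteq> k" using third \<open>k < 3\<close> by blast
    then show ?thesis unfolding Q_def using agree\<tau>[of i j k p] that by blast
  qed
  have Qloc: "\<exists>V. open V \<and> p \<in> V \<and> (\<forall>q\<in>V. M i q = M j q) \<and> V \<subseteq> W i j"
    if "i < 3" "j < 3" "p \<in> W i j" "M i p = M j p" for p i j
    using loc[OF that(1-3)] that(4) by auto
  have Qopen: "\<exists>V. open V \<and> p \<in> V \<and> (\<forall>q\<in>V. Q q)" if Qp: "Q p" for p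
  proof -
    obtain i j where ij: "i < 3" "j < 3" "i \<noteq> j" "p \<in> W i j" "M i p = M j p"
      using Qp unfolding Q_def by blast
    then obtain V where "open V" "p \<in> V" "\<forall>q\<in>V. M i q = M j q" "V \<subseteq> W i j"
      using Qloc[of i j p] by blast
    then show ?thesis using ij unfolding Q_def by blast
  qed
  \<comment> \<open>Induction along the connected circle. A point of the circle on a cut k lies in
    \<open>\<tau> k\<close>, where Q holds. Off the cuts all three branches are defined, and each of
    the three equations between them is locally constant.\<close>
  have Qall: "Q p" if p: "p \<in> sphere 0 R" for p
  proof -
    obtain p0 where p0: "p0 \<in> sphere 0 R" "Q p0" using meets Q\<tau> by blast
    have conS: "connected (sphere (0::complex) R)"
      by (rule connected_sphere) simp
    show ?thesis
    proof (rule connected_induction_simple[OF conS p0(1) p, of Q, OF p0(2)])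
      fix a assume a: "a \<in> sphere (0::complex) R"
      have "\<exists>V. open V \<and> a \<in> V \<and> (\<forall>x\<in>V. \<forall>y\<in>V. Q x \<longrightarrow> Q y)"
      proof (cases "\<exists>k<3. a \<in> \<rho> k")
        case True
        then have "Q a" using circ a Q\<tau> by blast
        then show ?thesis using Qopen[of a] by meson
      next
        case False
        then have aW: "a \<in> W i j" if "i < 3" "j < 3" for i j
          using that a U by (auto simp: W_def)
        obtain V01 where V01: "open V01" "a \<in> V01" "V01 \<subseteq> W 0 1"
          "\<forall>q\<in>V01. M 0 q = M 1 q \<longleftrightarrow> M 0 a = M 1 a"
          using loc[of 0 1 a] aW[of 0 1] by auto
        obtain V02 where V02: "open V02" "a \<in> V02" "V02 \<subseteq> W 0 2"
          "\<forall>q\<in>V02. M 0 q = M 2 q \<longleftrightarrow> M 0 a = M 2 a"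
          using loc[of 0 2 a] aW[of 0 2] by auto
        obtain V12 where V12: "open V12" "a \<in> V12" "V12 \<subseteq> W 1 2"
          "\<forall>q\<in>V12. M 1 q = M 2 q \<longleftrightarrow> M 1 a = M 2 a"
          using loc[of 1 2 a] aW[of 1 2] by auto
        define V where "V = V01 \<inter> V02 \<inter> V12"
        have eqV: "(M i q = M j q) = (M i a = M j a)" if "q \<in> V" "i < 3" "j < 3" for i j q
        proof -
          have "(M 0 q = M 1 q) = (M 0 a = M 1 a)" "(M 0 q = M 2 q) = (M 0 a = M 2 a)"
            "(M 1 q = M 2 q) = (M 1 a = M 2 a)"
            using V01(4) V02(4) V12(4) that(1) by (auto simp: V_def)
          then show ?thesis using that(2,3) unfolding less3 by metis
        qed
        have inW: "q \<in> W i j" if "q \<in> V" "i < 3" "j < 3" for i j q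
          using that V01(3) V02(3) V12(3) unfolding less3 V_def W_def by blast
        have "Q y" if that: "x \<in> V" "y \<in> V" "Q x" for x y
        proof -
          obtain i j where ij: "i < 3" "j < 3" "i \<noteq> j" "M i x = M j x"
            using \<open>Q x\<close> unfolding Q_def by blast
          then have "M i y = M j y" using eqV[of x i j] eqV[of y i j] that by simp
          then show ?thesis using ij inW[of y i j] that unfolding Q_def by blast
        qed
        moreover have "open V" "a \<in> V" using V01 V02 V12 by (auto simp: V_def)
        ultimately show ?thesis by blast
      qed
      then obtain V where "open V" "a \<in> V" "\<forall>x\<in>V. \<forall>y\<in>V. Q x \<longrightarrow> Q y" by blast
      then show "\<exists>T. openin (top_of_set (sphere 0 R)) T \<and> a \<in> T \<and> (\<forall>x\<in>T. \<forall>y\<in>T. Q x \<longrightarrow> Q y)"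
        using a by (intro exI[of _ "sphere 0 R \<inter> V"]) auto
    qed
  qed
  define g where "g = (\<lambda>p. SOME c. \<exists>i<3. \<exists>j<3. i \<noteq> j \<and> p \<in> W i j \<and> M i p = M j p \<and> c = M i p)"
  have g: "g p = M i p" if "i < 3" "j < 3" "i \<noteq> j" "p \<in> W i j" "M i p = M j p" for i j p
  proof -
    have "\<exists>i'<3. \<exists>j'<3. i' \<noteq> j' \<and> p \<in> W i' j' \<and> M i' p = M j' p \<and> g p = M i' p"
      unfolding g_def by (rule someI_ex) (use that in blast)
    then obtain i' j' where *: "i' < 3" "j' < 3" "i' \<noteq> j'" "M i' p = M j' p" "g p = M i' p" by blast
    \<comment> \<open>Two pairs out of three indices share an index, so the common value is
      independent of the chosen pair.\<close>
    have "i' = i \<or> i' = j \<or> j' = i \<or> j' = j"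
      using * that unfolding less3 by (elim disjE) simp_all
    then show ?thesis using * that by (elim disjE) simp_all
  qed
  have "continuous_on (sphere 0 R) g"
  proof (clarsimp simp only: continuous_on_eq_continuous_within)
    fix p assume "p \<in> sphere (0::complex) R"
    then obtain i j where ij: "i < 3" "j < 3" "i \<noteq> j" "p \<in> W i j" "M i p = M j p"
      using Qall unfolding Q_def by blast
    obtain V where V: "open V" "p \<in> V" "\<forall>q\<in>V. M i q = M j q" "V \<subseteq> W i j"
      using Qloc[OF ij(1,2,4,5)] by blast
    have "continuous_on V g"
      using continuous_on_subset[OF contW(1)[OF ij(1,2)] V(4)]
      by (rule continuous_on_eq) (use g[of i j] V ij in auto)
    then show "continuous (at p within sphere 0 R) g"
      using V by (simp add: continuous_at_imp_continuous_at_within continuous_on_eq_continuous_at)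
  qed
  moreover have "exp (g v) = v - 0" if v: "v \<in> sphere 0 R" for v
  proof -
    obtain i j where ij: "i < 3" "j < 3" "i \<noteq> j" "v \<in> W i j" "M i v = M j v"
      using Qall[OF v] unfolding Q_def by blast
    then show ?thesis using g[OF ij] expM[of i v] by (auto simp: W_def)
  qed
  ultimately show False
    using no_continuous_logarithm_on_circle[of 0 R g] R by simp
qed

section \<open>Busemann convex metrics on the plane\<close>

text \<open>Taking \<open>complex\<close> as carrier makes logarithms available. By
  \<open>open_iff\<close> the metric induces the usual topology, so library notions of continuity
  and compactness apply as they stand. Geodesics are parametrized proportionally on [0,1], so that
  two of different lengths can be compared at equal parameter.\<close>

locale busemann_plane =
  fixes d :: "complex \<Rightarrow> complex \<Rightarrow> real" and G :: "complex \<Rightarrow> complex \<Rightarrow> real \<Rightarrow> complex"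
  assumes nonneg: "0 \<le> d x y"
    and zero: "d x y = 0 \<longleftrightarrow> x = y"
    and commute: "d x y = d y x"
    and triangle: "d x z \<le> d x y + d y z"
    and open_iff: "open S \<longleftrightarrow> (\<forall>x\<in>S. \<exists>e>0. \<forall>y. d x y < e \<longrightarrow> y \<in> S)"
    and compact_ball: "compact {y. d x y \<le> b}"
    and G_0: "G x y 0 = x"
    and G_1: "G x y 1 = y"
    and G_dist: "\<lbrakk>s \<in> {0..1}; t \<in> {0..1}\<rbrakk> \<Longrightarrow> d (G x y s) (G x y t) = \<bar>s - t\<bar> * d x y"
    and G_convex: "t \<in> {0..1} \<Longrightarrow> d (G x y t) (G x z t) \<le> t * d y z"
    and G_unique: "\<lbrakk>t \<in> {0..1}; d x w = t * d x y; d w y = (1 - t) * d x y\<rbrakk> \<Longrightarrow> w = G x y t"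
begin

section \<open>Topology of the metric and continuity of geodesics\<close>

lemma self [simp]: "d x x = 0"
  by (simp add: zero)

lemma open_ball: "open {y. d x y < e}"
  unfolding open_iff
proof
  fix y assume y: "y \<in> {y. d x y < e}"
  show "\<exists>e'>0. \<forall>z. d y z < e' \<longrightarrow> z \<in> {y. d x y < e}"
  proof (intro exI[of _ "e - d x y"] conjI allI impI)
    fix z assume "d y z < e - d x y"
    then show "z \<in> {y. d x y < e}" using triangle[of x z y] by simp
  qed (use y in simp)
qed

lemma tendsto_iff: "(f \<longlongrightarrow> l) F \<longleftrightarrow> ((\<lambda>x. d (f x) l) \<longlongrightarrow> 0) F"
proof
  assume f: "(f \<longlongrightarrow> l) F"
  show "((\<lambda>x. d (f x) l) \<longlongrightarrow> 0) F"
  proof (rule tendstoI)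
    fix e :: real assume "e > 0"
    then have "\<forall>\<^sub>F x in F. f x \<in> {y. d l y < e}"
      by (intro topological_tendstoD[OF f open_ball]) simp
    then show "\<forall>\<^sub>F x in F. dist (d (f x) l) 0 < e"
      by eventually_elim (simp add: nonneg commute)
  qed
next
  assume f: "((\<lambda>x. d (f x) l) \<longlongrightarrow> 0) F"
  show "(f \<longlongrightarrow> l) F"
  proof (rule topological_tendstoI)
    fix S assume "open S" "l \<in> S"
    then obtain e where e: "e > 0" "\<And>y. d l y < e \<Longrightarrow> y \<in> S"
      unfolding open_iff by blast
    have "\<forall>\<^sub>F x in F. dist (d (f x) l) 0 < e"
      using tendstoD[OF f e(1)] .
    then show "\<forall>\<^sub>F x in F. f x \<in> S"
      by eventually_elim (use e(2) in \<open>simp add: nonneg commute\<close>)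
  qed
qed

lemma tendsto_d:
  assumes "(f \<longlongrightarrow> a) F" "(g \<longlongrightarrow> b) F"
  shows "((\<lambda>x. d (f x) (g x)) \<longlongrightarrow> d a b) F"
proof -
  have lim: "((\<lambda>x. d (f x) a + d (g x) b) \<longlongrightarrow> 0) F"
    using assms tendsto_add[of "\<lambda>x. d (f x) a" 0 F "\<lambda>x. d (g x) b" 0]
    unfolding tendsto_iff[of f] tendsto_iff[of g] by simp
  have "norm (d (f x) (g x) - d a b) \<le> d (f x) a + d (g x) b" for x
    using triangle[of "f x" "g x" a] triangle[of a "g x" b] triangle[of a b "f x"]
      triangle[of "f x" b "g x"] commute[of a "f x"] commute[of b "g x"]
    by (simp only: real_norm_def)
  then have "\<forall>\<^sub>F x in F. norm (d (f x) (g x) - d a b) \<le> d (f x) a + d (g x) b"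
    by (intro always_eventually allI)
  from Lim_null_comparison[OF this lim] have "((\<lambda>x. d (f x) (g x) - d a b) \<longlongrightarrow> 0) F" .
  then show ?thesis by (simp add: LIM_zero_iff)
qed

lemma continuous_on_d [continuous_intros]:
  assumes "continuous_on S f" "continuous_on S g"
  shows "continuous_on S (\<lambda>x. d (f x) (g x))"
  using assms unfolding continuous_on_def by (simp add: tendsto_d)

lemma dist_G_left: "t \<in> {0..1} \<Longrightarrow> d x (G x y t) = t * d x y"
  using G_dist[of 0 t x y] by (simp add: G_0)

lemma dist_G_right: "t \<in> {0..1} \<Longrightarrow> d (G x y t) y = (1 - t) * d x y"
  using G_dist[of t 1 x y] by (simp add: G_1)

lemma G_reverse: "t \<in> {0..1} \<Longrightarrow> G x y t = G y x (1 - t)"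
  using dist_G_left[of t x y] dist_G_right[of t x y]
  by (intro G_unique) (auto simp: commute)

text \<open>The data are changed one at a time: \<open>G_convex\<close> controls the terminal point,
  \<open>G_convex\<close> after reversal the initial point, and \<open>G_dist\<close> the
  parameter.\<close>

lemma tendsto_G:
  assumes f: "(f \<longlongrightarrow> a) F" and g: "(g \<longlongrightarrow> b) F" and h: "(h \<longlongrightarrow> t) F"
    and h01: "\<forall>\<^sub>F x in F. h x \<in> {0..1}" and t: "t \<in> {0..1}"
  shows "((\<lambda>x. G (f x) (g x) (h x)) \<longlongrightarrow> G a b t) F"
  unfolding tendsto_iff[of _ "G a b t"]
proof (rule Lim_null_comparison)
  have "((\<lambda>x. d (f x) a + d (g x) b + \<bar>h x - t\<bar> * d a b) \<longlongrightarrow> 0 + 0 + \<bar>t - t\<bar> * d a b) F"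
    using f g h unfolding tendsto_iff[of f] tendsto_iff[of g] by (intro tendsto_intros)
  then show "((\<lambda>x. d (f x) a + d (g x) b + \<bar>h x - t\<bar> * d a b) \<longlongrightarrow> 0) F" by simp
  show "\<forall>\<^sub>F x in F. norm (d (G (f x) (g x) (h x)) (G a b t)) \<le> d (f x) a + d (g x) b + \<bar>h x - t\<bar> * d a b"
    using h01
  proof eventually_elim
    case (elim x)
    then have elim': "1 - h x \<in> {0..1}" by auto
    have "d (G (f x) (g x) (h x)) (G (f x) b (h x)) \<le> h x * d (g x) b"
      using G_convex[OF elim] .
    also have "\<dots> \<le> d (g x) b" using elim nonneg by (simp add: mult_left_le_one_le)
    finally have 1: "d (G (f x) (g x) (h x)) (G (f x) b (h x)) \<le> d (g x) b" .
    have "d (G (f x) b (h x)) (G a b (h x)) \<le> (1 - h x) * d (f x) a"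
      using G_convex[OF elim', of b "f x" a] G_reverse[OF elim] by simp
    also have "\<dots> \<le> d (f x) a" using elim' nonneg by (simp add: mult_left_le_one_le)
    finally have 2: "d (G (f x) b (h x)) (G a b (h x)) \<le> d (f x) a" .
    show ?case
      using 1 2 G_dist[OF elim t, of a b] triangle[of "G (f x) (g x) (h x)" "G a b t" "G (f x) b (h x)"]
        triangle[of "G (f x) b (h x)" "G a b t" "G a b (h x)"] nonneg by simp
  qed
qed

lemma continuous_on_G [continuous_intros]:
  assumes "continuous_on S f" "continuous_on S g" "continuous_on S h" "\<And>x. x \<in> S \<Longrightarrow> h x \<in> {0..1}"
  shows "continuous_on S (\<lambda>x. G (f x) (g x) (h x))"
  unfolding continuous_on_def
proof
  fix x assume "x \<in> S"
  then show "((\<lambda>x. G (f x) (g x) (h x)) \<longlongrightarrow> G (f x) (g x) (h x)) (at x within S)"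
    using assms unfolding continuous_on_def
    by (intro tendsto_G) (auto simp: eventually_at_filter)
qed

text \<open>Compare with the point at parameter t on the geodesic from x to p: convexity bounds the
  distance between the two points by t times \<open>d y p\<close>, and the rest of that geodesic has
  length (1 - t) times \<open>d x p\<close>.\<close>

lemma dist_G_le:
  assumes t: "t \<in> {0..1}"
  shows "d p (G x y t) \<le> (1 - t) * d p x + t * d p y"
  using G_convex[OF t, of x y p] dist_G_right[OF t, of x p]
    triangle[of p "G x y t" "G x p t"] commute[of p "G x p t"] commute[of x p] commute[of y p]
    commute[of "G x p t" "G x y t"]
  by simp

lemma dist_G_le_bound:
  assumes t: "t \<in> {0..1}" and "d p x \<le> b" "d p y \<le> b"
  shows "d p (G x y t) \<le> b"
proof -
  have "d p (G x y t) \<le> (1 - t) * d p x + t * d p y" using dist_G_le[OF t] .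
  also have "\<dots> \<le> (1 - t) * b + t * b"
    using assms by (intro add_mono mult_left_mono) auto
  finally show ?thesis by (simp add: algebra_simps)
qed

text \<open>Follows from uniqueness. Consequently two geodesics from one point that meet at equal
  distance agree up to the meeting point.\<close>

lemma G_initial:
  assumes s: "s \<in> {0..1}" and t: "t \<in> {0..1}"
  shows "G x (G x y t) s = G x y (s * t)"
proof -
  have st: "s * t \<in> {0..1}" using s t by (auto intro: mult_le_one)
  have "s * t \<le> t" using s t by (simp add: mult_left_le_one_le)
  then have "\<bar>s * t - t\<bar> = (1 - s) * t" by (simp add: algebra_simps)
  then have "d (G x y (s * t)) (G x y t) = (1 - s) * (t * d x y)"
    using G_dist[OF st t, of x y] by simp
  then have "G x y (s * t) = G x (G x y t) s"
    by (intro G_unique[OF s]) (use dist_G_left[OF t] dist_G_left[OF st] in auto)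
  then show ?thesis by simp
qed

definition seg :: "complex \<Rightarrow> complex \<Rightarrow> complex set" where
  "seg x y = G x y ` {0..1}"

lemma compact_seg: "compact (seg x y)"
  unfolding seg_def by (intro compact_continuous_image continuous_intros) auto

lemma connected_seg: "connected (seg x y)"
  unfolding seg_def by (intro connected_continuous_image continuous_intros) auto

lemma ends_in_seg: "x \<in> seg x y" "y \<in> seg x y"
  unfolding seg_def by (force simp: G_0 G_1 intro: image_eqI[of _ _ 0] image_eqI[of _ _ 1])+

lemma ball_subset_euclidean_ball: obtains R where "R > 0" "{v. d x v \<le> b} \<subseteq> ball 0 R"
  using bounded_subset_ballD[OF compact_imp_bounded[OF compact_ball[of x b]], of 0] by blast

lemma euclidean_ball_subset_ball: obtains b where "b > c" "cball 0 R \<subseteq> {v. d x v < b}"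
proof -
  have "compact (d x ` cball 0 R)"
    by (intro compact_continuous_image continuous_intros) auto
  then obtain B where B: "\<And>v. v \<in> cball 0 R \<Longrightarrow> \<bar>d x v\<bar> \<le> B"
    using compact_imp_bounded bounded_real by (metis imageI)
  show ?thesis
    by (rule that[of "max B c + 1"]) (use B in force)+
qed

section \<open>Prolonged radial geodesics as cuts of the plane\<close>

lemma contractible_ball:
  assumes "b > 0"
  shows "contractible {v. d 0 v < b}"
proof -
  have le: "(1 - s) * d v 0 < b" if "0 \<le> s" "s \<le> 1" "d 0 v < b" for s v
  proof -
    have "(1 - s) * d v 0 \<le> d v 0" using that nonneg by (simp add: mult_left_le_one_le)
    then show ?thesis using that commute[of 0 v] by simp
  qed
  have "homotopic_with_canon (\<lambda>x. True) {v. d 0 v < b} {v. d 0 v < b} id (\<lambda>x. 0)"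
    unfolding homotopic_with_def
  proof (intro exI[of _ "\<lambda>(s, v). G v 0 s"] conjI)
    have "continuous_on ({0..1} \<times> {v. d 0 v < b}) (\<lambda>(s, v). G v 0 s)"
      unfolding case_prod_unfold by (intro continuous_intros) auto
    moreover have "d 0 (G v 0 s) < b" if "0 \<le> s" "s \<le> 1" "d 0 v < b" for s v
      using le[OF that] dist_G_right[of s v 0] that commute[of 0 "G v 0 s"] by simp
    ultimately show "continuous_map (prod_topology (top_of_set {0..1}) (top_of_set {v. d 0 v < b}))
        (top_of_set {v. d 0 v < b}) (\<lambda>(s, v). G v 0 s)"
      by (auto simp: continuous_map_subtopology_eu simp flip: subtopology_Times)
  qed (auto simp: G_0 G_1)
  then show ?thesis unfolding contractible_def by blast
qed

text \<open>A geodesic from \<open>0\<close> to \<open>x\<close> can be prolonged: otherwise contracting a large circle along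
  geodesics to \<open>0\<close> would avoid \<open>x\<close>.\<close>

lemma geodesic_extension:
  assumes b: "d 0 x \<le> b"
  obtains y where "d 0 y = b" "x \<in> seg 0 y"
proof -
  obtain R where R: "R > 0" "{v. d 0 v \<le> b} \<subseteq> ball 0 R" by (rule ball_subset_euclidean_ball)
  have far: "b < d 0 v" if "v \<in> sphere 0 R" for v
    using R(2) that by force
  have "\<exists>v\<in>sphere 0 R. x \<in> seg 0 v"
  proof (rule ccontr)
    assume "\<not> ?thesis"
    then have avoid: "G v 0 s \<noteq> x" if "0 \<le> s" "s \<le> 1" "v \<in> sphere 0 R" for s v
      using G_reverse[of s v 0] that unfolding seg_def by force
    \<comment> \<open>At s = 1 the circle is contracted to 0, leaving the constant -x, which has the
      logarithm \<open>Ln (- x)\<close>.\<close>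
    have "0 \<noteq> x" using avoid[of 1 R] R(1) by (auto simp: G_1)
    then have "exp (Ln (- x)) = G v 0 1 - x" for v by (simp add: G_1)
    then obtain h where h: "continuous_on (sphere 0 R) h"
      "\<And>v. v \<in> sphere 0 R \<Longrightarrow> exp (h v) = G v 0 0 - x"
      by (rule_tac continuous_logarithm_homotopy[of "sphere 0 R" "\<lambda>s v. G v 0 s - x" "\<lambda>_. Ln (- x)"])
        (use avoid in \<open>auto simp: case_prod_unfold intro!: continuous_intros\<close>)
    moreover have "norm x < R" using b R(2) by auto
    ultimately show False using no_continuous_logarithm_on_circle[of x R h] by (simp add: G_0)
  qed
  then obtain v s where v: "v \<in> sphere 0 R" and s: "s \<in> {0..1}" "x = G 0 v s"
    unfolding seg_def by blast
  have pos: "d 0 v > 0" "b \<ge> 0" "d 0 v > b" using far[OF v] b nonneg[of 0 x] by auto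
  \<comment> \<open>The geodesic found runs out to the Euclidean circle, beyond distance b; it is
    cut back to length b. Since s \<le> t, the point x survives the cut.\<close>
  define t where "t = b / d 0 v"
  have t: "t \<in> {0..1}" using pos by (simp add: t_def)
  have st: "s \<le> t" using b s dist_G_left[OF s(1), of 0 v] pos by (simp add: t_def field_simps)
  have "d 0 (G 0 v t) = b" using dist_G_left[OF t, of 0 v] pos by (simp add: t_def)
  moreover have "x \<in> seg 0 (G 0 v t)"
  proof (cases "t = 0")
    case True
    then show ?thesis using st s by (auto simp: ends_in_seg G_0)
  next
    case False
    then have "s / t \<in> {0..1}" using st s t by (simp add: divide_le_eq_1)
    then have "G 0 (G 0 v t) (s / t) = x" using G_initial[OF _ t, of "s / t" 0 v] s False by simp
    then show ?thesis unfolding seg_def using \<open>s / t \<in> {0..1}\<close> by blast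
  qed
  ultimately show ?thesis using that by blast
qed

text \<open>On the open ball, which is contractible, v - y has a logarithm, as y lies outside.
  Sliding y to 0 along the cut keeps the difference nonzero for v off the cut.\<close>

lemma logarithm_off_cut:
  assumes y: "d 0 y = b" and b: "b > 0"
  obtains L where "continuous_on ({v. d 0 v < b} - seg 0 y) L"
    "\<And>v. v \<in> {v. d 0 v < b} - seg 0 y \<Longrightarrow> exp (L v) = v"
proof -
  obtain g where g: "continuous_on {v. d 0 v < b} g" "\<And>v. v \<in> {v. d 0 v < b} \<Longrightarrow> v - y = exp (g v)"
  proof (rule continuous_logarithm_on_contractible[OF _ contractible_ball[OF b]])
    show "continuous_on {v. d 0 v < b} (\<lambda>v. v - y)" by (intro continuous_intros)
    show "v - y \<noteq> 0" if "v \<in> {v. d 0 v < b}" for v using that y by auto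
  qed blast
  have nz: "v - G 0 y s \<noteq> 0" if "0 \<le> s" "s \<le> 1" "v \<notin> seg 0 y" for s v
    using that unfolding seg_def by force
  obtain L where "continuous_on ({v. d 0 v < b} - seg 0 y) L"
    "\<And>v. v \<in> {v. d 0 v < b} - seg 0 y \<Longrightarrow> exp (L v) = v - G 0 y 0"
  proof (rule continuous_logarithm_homotopy[of "{v. d 0 v < b} - seg 0 y" "\<lambda>s v. v - G 0 y s" g])
    show "continuous_on ({0..1} \<times> ({v. d 0 v < b} - seg 0 y)) (\<lambda>(s, v). v - G 0 y s)"
      unfolding case_prod_unfold by (intro continuous_intros) auto
    show "continuous_on ({v. d 0 v < b} - seg 0 y) g" by (rule continuous_on_subset[OF g(1)]) auto
    show "exp (g v) = v - G 0 y 1" if "v \<in> {v. d 0 v < b} - seg 0 y" for v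
      using g(2)[of v] that by (simp add: G_1)
  qed (use nz in auto)
  then show ?thesis using that by (simp add: G_0)
qed

text \<open>The geodesics to the \<open>x i\<close> are prolonged to length b, where a Euclidean
  circle fits between the metric spheres of radius a and b. The cuts may share pieces inside radius
  a, but their outer parts are disjoint.\<close>

lemma no_claw:
  fixes x :: "nat \<Rightarrow> complex" and Z :: "nat \<Rightarrow> complex set"
  assumes x: "\<And>i. i < 3 \<Longrightarrow> d 0 (x i) = a"
    and neq: "\<And>i j. \<lbrakk>i < 3; j < 3; i \<noteq> j\<rbrakk> \<Longrightarrow> x i \<noteq> x j"
    and conn: "\<And>i. i < 3 \<Longrightarrow> connected (Z i)"
    and Za: "\<And>i. i < 3 \<Longrightarrow> Z i \<subseteq> {v. d 0 v \<le> a}"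
    and z: "\<And>i. i < 3 \<Longrightarrow> z \<in> Z i"
    and xZ: "\<And>i. i < 3 \<Longrightarrow> x i \<in> Z i"
    and disj: "\<And>i j. \<lbrakk>i < 3; j < 3; i \<noteq> j\<rbrakk> \<Longrightarrow> Z i \<inter> seg 0 (x j) = {}"
  shows False
proof -
  have "a > 0"
  proof (rule ccontr)
    assume "\<not> a > 0"
    then have "a = 0" using x[of 0] nonneg[of 0 "x 0"] by simp
    then show False using x[of 0] x[of 1] neq[of 0 1] zero by simp
  qed
  obtain R where R: "R > 0" "{v. d 0 v \<le> a} \<subseteq> ball 0 R" by (rule ball_subset_euclidean_ball)
  obtain b where b: "b > a" "cball 0 R \<subseteq> {v. d 0 v < b}" by (rule euclidean_ball_subset_ball)
  have far: "a < d 0 v" if "v \<in> sphere 0 R" for v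
    using R(2) that by force
  have "\<exists>y. d 0 y = b \<and> x i \<in> seg 0 y" if "i < 3" for i
    using geodesic_extension[of "x i" b] x[OF that] b by (metis less_imp_le)
  then obtain y where y: "\<And>i. i < 3 \<Longrightarrow> d 0 (y i) = b" "\<And>i. i < 3 \<Longrightarrow> x i \<in> seg 0 (y i)"
    by metis
  \<comment> \<open>The parameter at which every prolonged geodesic crosses radius a, necessarily at
    \<open>x i\<close>.\<close>
  define c where "c = a / b"
  have c: "c \<in> {0..1}" "0 < c" "c < 1" "c * b = a" using \<open>a > 0\<close> b by (auto simp: c_def)
  have Gy: "d 0 (G 0 (y i) s) = s * b" if "i < 3" "s \<in> {0..1}" for i s
    using dist_G_left[OF that(2)] y(1)[OF that(1)] by simp
  have xc: "x i = G 0 (y i) c" if i: "i < 3" for i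
  proof -
    obtain s where s: "s \<in> {0..1}" "x i = G 0 (y i) s" using y(2)[OF i] unfolding seg_def by blast
    then have "s * b = c * b" using Gy[OF i s(1)] x[OF i] c by simp
    then show ?thesis using s \<open>a > 0\<close> b by simp
  qed
  have "\<exists>L. continuous_on ({v. d 0 v < b} - seg 0 (y i)) L \<and>
          (\<forall>v\<in>{v. d 0 v < b} - seg 0 (y i). exp (L v) = v)" if i: "i < 3" for i
  proof -
    have "b > 0" using \<open>a > 0\<close> b by simp
    then show ?thesis using logarithm_off_cut[OF y(1)[OF i]] by metis
  qed
  then obtain L where L: "\<And>i. i < 3 \<Longrightarrow> continuous_on ({v. d 0 v < b} - seg 0 (y i)) (L i)"
    "\<And>i v. i < 3 \<Longrightarrow> v \<in> {v. d 0 v < b} - seg 0 (y i) \<Longrightarrow> exp (L i v) = v"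
    by metis
  \<comment> \<open>The parameter 1 is excluded because \<open>y i\<close> lies on the boundary of
    the open ball of radius b.\<close>
  define \<tau> where "\<tau> = (\<lambda>i. G 0 (y i) ` {c..<1})"
  have sub: "sphere (0::complex) R \<subseteq> cball 0 R" by auto
  have circ: "sphere 0 R \<inter> seg 0 (y i) \<subseteq> \<tau> i" if i: "i < 3" for i
  proof
    fix p assume p: "p \<in> sphere 0 R \<inter> seg 0 (y i)"
    then obtain s where s: "s \<in> {0..1}" "p = G 0 (y i) s" unfolding seg_def by blast
    have "a < s * b" "s * b < b" using far[of p] b(2) sub p Gy[OF i s(1)] s by auto
    then have "c < s" "s < 1" using \<open>a > 0\<close> b by (auto simp: c_def field_simps)
    then show "p \<in> \<tau> i" using s by (auto simp: \<tau>_def)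
  qed
  show False
  proof (rule no_claw_across_three_cuts[of "{v. d 0 v < b}" R "\<lambda>i. seg 0 (y i)" L \<tau> 0 Z z])
    show "open {v. d 0 v < b}" by (rule open_ball)
    show "sphere 0 R \<subseteq> {v. d 0 v < b}" using b(2) sub by blast
    show "closed (seg 0 (y i))" for i using compact_seg compact_imp_closed by blast
    show "connected (\<tau> i)" for i
      unfolding \<tau>_def using c by (intro connected_continuous_image continuous_intros) auto
    show "\<tau> i \<subseteq> {v. d 0 v < b}" if "i < 3" for i
      using Gy[OF that] c \<open>a > 0\<close> b by (auto simp: \<tau>_def)
    \<comment> \<open>A common point has one distance from 0, hence the same parameter on both cuts.
      The cuts then agree below it, in particular at parameter c, which gives
      \<open>x i = x j\<close>.\<close>
    show "\<tau> i \<inter> seg 0 (y j) = {}" if ij: "i < 3" "j < 3" "i \<noteq> j" for i j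
    proof (rule ccontr)
      assume "\<tau> i \<inter> seg 0 (y j) \<noteq> {}"
      then obtain s t where s: "s \<in> {c..<1}" and t: "t \<in> {0..1}" and eq: "G 0 (y i) s = G 0 (y j) t"
        unfolding \<tau>_def seg_def by blast
      have s': "s \<in> {0..1}" "c / s \<in> {0..1}" "s \<noteq> 0" using s c by auto
      have "s = t" using Gy[OF ij(1) s'(1)] Gy[OF ij(2) t] eq \<open>a > 0\<close> b by simp
      then have "x i = x j"
        using G_initial[OF s'(2,1), of 0 "y i"] G_initial[OF s'(2,1), of 0 "y j"] eq s'(3)
          xc[OF ij(1)] xc[OF ij(2)] by simp
      then show False using neq[OF ij] by simp
    qed
    show "sphere 0 R \<inter> \<tau> 0 \<noteq> {}"
    proof -
      have "seg 0 (y 0) \<inter> frontier (ball 0 R) \<noteq> {}"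
      proof (rule connected_Int_frontier[OF connected_seg])
        show "seg 0 (y 0) \<inter> ball 0 R \<noteq> {}" using R(1) ends_in_seg(1)[of 0 "y 0"] by force
        have "y 0 \<notin> cball 0 R" using b(2) y(1)[of 0] by auto
        then show "seg 0 (y 0) - ball 0 R \<noteq> {}" using ends_in_seg(2)[of "y 0" 0] by force
      qed
      then show ?thesis using circ[of 0] R(1) by (auto simp: frontier_ball)
    qed
    show "Z i \<subseteq> {v. d 0 v < b}" if "i < 3" for i using Za[OF that] b(1) by auto
    show "Z i \<inter> \<tau> i \<noteq> {}" if "i < 3" for i
      using xZ[OF that] xc[OF that] c by (auto simp: \<tau>_def)
    \<comment> \<open>As \<open>Z i\<close> stays within distance a of 0, it can only meet the part
      of the cut up to parameter c, which is \<open>seg 0 (x j)\<close>.\<close>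
    show "Z i \<inter> seg 0 (y j) = {}" if ij: "i < 3" "j < 3" "i \<noteq> j" for i j
    proof (rule ccontr)
      assume "Z i \<inter> seg 0 (y j) \<noteq> {}"
      then obtain t where t: "t \<in> {0..1}" "G 0 (y j) t \<in> Z i" unfolding seg_def by blast
      have "t * b \<le> a" using Za[OF ij(1)] t Gy[OF ij(2) t(1)] by force
      then have "t \<le> c" using \<open>a > 0\<close> b by (simp add: c_def field_simps)
      then have tc: "t / c \<in> {0..1}" using c t by simp
      then have "G 0 (x j) (t / c) = G 0 (y j) t"
        using G_initial[OF tc c(1), of 0 "y j"] xc[OF ij(2)] c(2) by simp
      then show False using disj[OF ij] t tc unfolding seg_def by force
    qed
  qed (use R L circ conn z in auto)
qed

end

section \<open>Coarse components\<close>

definition chain_rel :: "('a \<Rightarrow> 'a \<Rightarrow> real) \<Rightarrow> real \<Rightarrow> 'a set \<Rightarrow> 'a rel" where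
  "chain_rel d s T = {(x, y). x \<in> T \<and> y \<in> T \<and> d x y \<le> s}"

text \<open>Encodes a bounded disjoint family by its union T: the members are the chain components
  of T, and points of different components are automatically more than s apart.\<close>

definition chain_bounded :: "('a \<Rightarrow> 'a \<Rightarrow> real) \<Rightarrow> real \<Rightarrow> real \<Rightarrow> 'a set \<Rightarrow> bool" where
  "chain_bounded d s B T \<longleftrightarrow> (\<forall>x\<in>T. \<forall>y. (x, y) \<in> (chain_rel d s T)\<^sup>* \<longrightarrow> d x y \<le> B)"

lemma chain_rel_mono: "T \<subseteq> T' \<Longrightarrow> s \<le> s' \<Longrightarrow> chain_rel d s T \<subseteq> chain_rel d s' T'"
  by (auto simp: chain_rel_def)

lemma chain_bounded_mono:
  assumes "chain_bounded d s' B T'" "T \<subseteq> T'" "s \<le> s'" "B \<le> B'"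
  shows "chain_bounded d s B' T"
  using assms rtrancl_mono[OF chain_rel_mono[OF assms(2,3), of d]]
  unfolding chain_bounded_def by (meson order_trans subsetD)

lemma chain_rtrancl_in: "(x, y) \<in> (chain_rel d s T)\<^sup>* \<Longrightarrow> x \<in> T \<Longrightarrow> y \<in> T"
  by (induction rule: rtrancl_induct) (auto simp: chain_rel_def)

lemma chain_rtrancl_map:
  assumes "(x, y) \<in> (chain_rel d s T)\<^sup>*"
    and "\<And>x y. \<lbrakk>x \<in> T; y \<in> T; d x y \<le> s\<rbrakk> \<Longrightarrow> f x \<in> T' \<and> f y \<in> T' \<and> d' (f x) (f y) \<le> s'"
  shows "(f x, f y) \<in> (chain_rel d' s' T')\<^sup>*"
  using assms(1)
proof (induction rule: rtrancl_induct)
  case (step y z)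
  then have "(f y, f z) \<in> chain_rel d' s' T'"
    using assms(2)[of y z] by (auto simp: chain_rel_def)
  then show ?case using step.IH by (rule rtrancl_into_rtrancl[rotated])
qed simp

text \<open>The choice is made from the whole class of x, so it depends on the class alone.\<close>

lemma component_representative:
  assumes "sym E"
  obtains \<rho> where "\<And>x. (x, \<rho> x) \<in> E\<^sup>*" "\<And>x y. (x, y) \<in> E\<^sup>* \<Longrightarrow> \<rho> x = \<rho> y"
proof
  show "(x, SOME z. z \<in> E\<^sup>* `` {x}) \<in> E\<^sup>*" for x
    using someI[of "\<lambda>z. z \<in> E\<^sup>* `` {x}" x] by simp
  show "(SOME z. z \<in> E\<^sup>* `` {x}) = (SOME z. z \<in> E\<^sup>* `` {y})" if "(x, y) \<in> E\<^sup>*" for x y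
  proof -
    have "(y, x) \<in> E\<^sup>*" using that sym_rtrancl[OF assms] by (meson symD)
    then have "E\<^sup>* `` {x} = E\<^sup>* `` {y}" using that by (auto intro: rtrancl_trans)
    then show ?thesis by simp
  qed
qed

context Metric_space
begin

lemma sym_chain_rel: "sym (chain_rel d s T)"
  by (intro symI) (auto simp: chain_rel_def commute)

lemma sym_chain: "sym ((chain_rel d s T)\<^sup>*)"
  by (intro sym_rtrancl sym_chain_rel)

text \<open>A chain in \<open>P \<union> Q\<close> spends between two consecutive visits to \<open>Q\<close> only a bounded distance in
  \<open>P\<close>, so its visits to \<open>Q\<close> form a coarser chain.\<close>

lemma chain_bounded_Un:
  assumes PM: "P \<subseteq> M" and QM: "Q \<subseteq> M"
    and P: "chain_bounded d r K P" and Q: "chain_bounded d (K + 2 * r) K' Q"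
    and pos: "0 \<le> r" "0 \<le> K" "0 \<le> K'"
  shows "chain_bounded d r (2 * (K' + r + K)) (P \<union> Q)"
proof -
  let ?R = "chain_rel d r (P \<union> Q)"
  \<comment> \<open>Here q' is the last visit to Q. An excursion costs a step r into P, at most K
    inside P and a step r back, whence the scale K + 2 r on Q.\<close>
  have claim: "\<exists>q'\<in>Q. (q, q') \<in> (chain_rel d (K + 2 * r) Q)\<^sup>* \<and>
      (y = q' \<or> (\<exists>p\<in>P. d q' p \<le> r \<and> (p, y) \<in> (chain_rel d r P)\<^sup>*))"
    if "(q, y) \<in> ?R\<^sup>*" "q \<in> Q" for q y
    using that(1)
  proof (induction rule: rtrancl_induct)
    case base
    then show ?case using \<open>q \<in> Q\<close> by blast
  next
    case (step y z)
    then obtain q' where q': "q' \<in> Q" "(q, q') \<in> (chain_rel d (K + 2 * r) Q)\<^sup>*"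
      and y: "y = q' \<or> (\<exists>p\<in>P. d q' p \<le> r \<and> (p, y) \<in> (chain_rel d r P)\<^sup>*)" by blast
    have yz: "y \<in> P \<union> Q" "z \<in> P \<union> Q" "d y z \<le> r" using step.hyps(2) by (auto simp: chain_rel_def)
    have M: "y \<in> M" "z \<in> M" "q' \<in> M" using yz q' PM QM by auto
    show ?case
    proof (cases "z \<in> Q")
      case True
      have "d q' z \<le> K + 2 * r"
        using y
      proof
        assume "y = q'"
        then show ?thesis using yz(3) pos by simp
      next
        assume "\<exists>p\<in>P. d q' p \<le> r \<and> (p, y) \<in> (chain_rel d r P)\<^sup>*"
        then obtain p where p: "p \<in> P" "d q' p \<le> r" "(p, y) \<in> (chain_rel d r P)\<^sup>*" by blast
        then have "d p y \<le> K" using P by (auto simp: chain_bounded_def)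
        moreover have "p \<in> M" using p PM by auto
        ultimately show ?thesis
          using triangle[of q' p z] triangle[of p y z] M p(2) yz(3) by simp
      qed
      then have "(q', z) \<in> chain_rel d (K + 2 * r) Q" using True q'(1) by (simp add: chain_rel_def)
      with q'(2) have "(q, z) \<in> (chain_rel d (K + 2 * r) Q)\<^sup>*" by (rule rtrancl_into_rtrancl)
      then show ?thesis using True by blast
    next
      case False
      then have z: "z \<in> P" using yz by simp
      show ?thesis
      proof (cases "y = q'")
        case True
        then show ?thesis using q' z yz(3) by blast
      next
        case False
        then obtain p where p: "p \<in> P" "d q' p \<le> r" "(p, y) \<in> (chain_rel d r P)\<^sup>*" using y by blast
        then have "(y, z) \<in> chain_rel d r P"
          using chain_rtrancl_in[OF p(3,1)] z yz(3) by (simp add: chain_rel_def)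
        with p(3) have "(p, z) \<in> (chain_rel d r P)\<^sup>*" by (rule rtrancl_into_rtrancl)
        then show ?thesis using q' p(1,2) by blast
      qed
    qed
  qed
  have from_Q: "d q y \<le> K' + r + K" if q: "q \<in> Q" and qy: "(q, y) \<in> ?R\<^sup>*" for q y
  proof -
    obtain q' where q': "q' \<in> Q" "(q, q') \<in> (chain_rel d (K + 2 * r) Q)\<^sup>*"
      and y: "y = q' \<or> (\<exists>p\<in>P. d q' p \<le> r \<and> (p, y) \<in> (chain_rel d r P)\<^sup>*)"
      using claim[OF qy q] by blast
    have qq': "d q q' \<le> K'" using Q q q'(2) by (auto simp: chain_bounded_def)
    show ?thesis using y
    proof
      assume "y = q'"
      then show ?thesis using qq' pos by simp
    next
      assume "\<exists>p\<in>P. d q' p \<le> r \<and> (p, y) \<in> (chain_rel d r P)\<^sup>*"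
      then obtain p where p: "p \<in> P" "d q' p \<le> r" "(p, y) \<in> (chain_rel d r P)\<^sup>*" by blast
      then have "d p y \<le> K" using P by (auto simp: chain_bounded_def)
      moreover have "q \<in> M" "q' \<in> M" "p \<in> M" "y \<in> M"
        using q q'(1) p PM QM chain_rtrancl_in[OF p(3,1)] by auto
      ultimately show ?thesis
        using triangle[of q q' y] triangle[of q' p y] qq' p(2) by simp
    qed
  qed
  \<comment> \<open>Either both ends are reached from one point of Q, which doubles the bound
    \<open>from_Q\<close>, or the chain never meets Q and is a chain in P.\<close>
  have "d x y \<le> 2 * (K' + r + K)" if x: "x \<in> P \<union> Q" and xy: "(x, y) \<in> ?R\<^sup>*" for x y
  proof (cases "\<exists>q\<in>Q. (x, q) \<in> ?R\<^sup>*")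
    case True
    then obtain q where q: "q \<in> Q" "(x, q) \<in> ?R\<^sup>*" by blast
    then have qx: "(q, x) \<in> ?R\<^sup>*" by (meson symD sym_chain)
    then have "(q, y) \<in> ?R\<^sup>*" using xy by simp
    moreover have "x \<in> M" "y \<in> M" "q \<in> M" using x q(1) chain_rtrancl_in[OF xy x] PM QM by auto
    ultimately show ?thesis
      using from_Q[OF q(1) qx] from_Q[OF q(1), of y] triangle[of x q y] commute[of x q] by simp
  next
    case False
    then have xP: "x \<in> P" using x by auto
    have "(x, y) \<in> (chain_rel d r P)\<^sup>*"
      using xy
    proof (induction rule: rtrancl_induct)
      case (step y z)
      then have "y \<in> P" "z \<in> P" "d y z \<le> r"
        using False rtrancl_into_rtrancl[OF step.hyps] by (auto simp: chain_rel_def)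
      then have "(y, z) \<in> chain_rel d r P" by (simp add: chain_rel_def)
      then show ?case using step.IH by (rule rtrancl_into_rtrancl[rotated])
    qed simp
    then have "d x y \<le> K" using P xP by (auto simp: chain_bounded_def)
    then show ?thesis using pos by simp
  qed
  then show ?thesis by (simp add: chain_bounded_def)
qed

text \<open>Discrete intermediate value theorem: a step has length at most D, so the first point
  beyond distance m overshoots by at most D.\<close>

lemma chain_intermediate:
  assumes "(x, y) \<in> (chain_rel d D T)\<^sup>*" "x \<in> T" "T \<subseteq> M" "0 \<le> m" "m < d x y"
  shows "\<exists>w. (x, w) \<in> (chain_rel d D T)\<^sup>* \<and> m < d x w \<and> d x w \<le> m + D"
  using assms(1,5)
proof (induction rule: rtrancl_induct)
  case base
  then show ?case using assms by (metis mdist_zero not_le subsetD)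
next
  case (step y z)
  show ?case
  proof (cases "m < d x y")
    case True
    then show ?thesis using step.IH by blast
  next
    case False
    have "x \<in> M" "y \<in> M" "z \<in> M" "d y z \<le> D"
      using assms step.hyps(2) by (auto simp: chain_rel_def)
    then have "d x z \<le> m + D" using False triangle[of x y z] by simp
    moreover have "(x, z) \<in> (chain_rel d D T)\<^sup>*" using step.hyps by (rule rtrancl_into_rtrancl)
    ultimately show ?thesis using step.prems by blast
  qed
qed

text \<open>The required families consist of the coarse components of the sets
  \<open>T k\<close>.\<close>

lemma asdim_leI:
  assumes "\<And>r. r > 0 \<Longrightarrow> \<exists>T B. M \<subseteq> (\<Union>k\<in>{0..n}. T k) \<and>
             (\<forall>k\<in>{0..n}. T k \<subseteq> M \<and> chain_bounded d r B (T k))"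
  shows "asdim_le M d n"
  unfolding asdim_le_def
proof (intro allI impI)
  fix r :: real assume r: "r > 0"
  \<comment> \<open>Components at scale r would only give an infimum of distances at least r; the
    scale r + 1 makes it strictly larger than r.\<close>
  then have "r + 1 > 0" by simp
  from assms[OF this] obtain T :: "int \<Rightarrow> 'a set" and B where cover: "M \<subseteq> (\<Union>k\<in>{0..n}. T k)"
    and T: "\<And>k. k \<in> {0..n} \<Longrightarrow> T k \<subseteq> M" "\<And>k. k \<in> {0..n} \<Longrightarrow> chain_bounded d (r + 1) B (T k)"
    by blast
  define C where "C k x = (chain_rel d (r + 1) (T k))\<^sup>* `` {x}" for k x
  define \<U> where "\<U> k = C k ` T k" for k
  have C_sub: "C k x \<subseteq> T k" if "x \<in> T k" for k x
    using chain_rtrancl_in that by (fastforce simp: C_def)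
  have "\<U> k \<subseteq> Pow M \<and> uniformly_bounded_family d (\<U> k) \<and> r_disjoint_family d r (\<U> k)"
    if k: "k \<in> {0..n}" for k
  proof (intro conjI)
    show "\<U> k \<subseteq> Pow M" using C_sub T(1)[OF k] by (fastforce simp: \<U>_def)
    show "uniformly_bounded_family d (\<U> k)"
      unfolding uniformly_bounded_family_def
    proof (intro exI[of _ "max 1 (2 * B)"] conjI ballI)
      fix U assume "U \<in> \<U> k"
      then obtain x where x: "x \<in> T k" "U = C k x" by (auto simp: \<U>_def)
      have "d u v \<le> max 1 (2 * B)" if "u \<in> U" "v \<in> U" for u v
      proof -
        have "u \<in> M" "v \<in> M" "x \<in> M" using that x C_sub T(1)[OF k] by blast+
        moreover have "d x u \<le> B" "d x v \<le> B"
          using T(2)[OF k] x that by (auto simp: chain_bounded_def C_def)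
        ultimately show ?thesis using triangle[of u x v] commute[of u x] by simp
      qed
      then show "set_diam d U \<le> ennreal (max 1 (2 * B))"
        unfolding set_diam_def by (intro SUP_least) (auto intro!: ennreal_leI)
    qed simp
    show "r_disjoint_family d r (\<U> k)"
      unfolding r_disjoint_family_def
    proof (intro ballI impI)
      fix U V assume UV: "U \<in> \<U> k" "V \<in> \<U> k" "U \<noteq> V"
      then obtain x y where x: "x \<in> T k" "U = C k x" and y: "y \<in> T k" "V = C k y"
        by (auto simp: \<U>_def)
      have "r + 1 \<le> d u v" if "u \<in> U" "v \<in> V" for u v
      proof (rule ccontr)
        assume "\<not> r + 1 \<le> d u v"
        moreover have "u \<in> T k" "v \<in> T k" using that x y C_sub by blast+
        ultimately have "(u, v) \<in> (chain_rel d (r + 1) (T k))\<^sup>*"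
          by (auto simp: chain_rel_def)
        moreover have xu: "(x, u) \<in> (chain_rel d (r + 1) (T k))\<^sup>*"
          and "(y, v) \<in> (chain_rel d (r + 1) (T k))\<^sup>*" using that x y by (auto simp: C_def)
        moreover have "(v, y) \<in> (chain_rel d (r + 1) (T k))\<^sup>*"
          using calculation(3) by (meson symD sym_chain)
        ultimately have xy: "(x, y) \<in> (chain_rel d (r + 1) (T k))\<^sup>*" by (meson rtrancl_trans)
        then have "(y, x) \<in> (chain_rel d (r + 1) (T k))\<^sup>*" by (meson symD sym_chain)
        with xy have "C k x = C k y" unfolding C_def by (auto intro: rtrancl_trans)
        then show False using UV x y by simp
      qed
      then have "ennreal (r + 1) \<le> set_distance d U V"
        unfolding set_distance_def by (intro INF_greatest) (auto intro!: ennreal_leI)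
      moreover have "ennreal r < ennreal (r + 1)" using r by (intro ennreal_lessI) auto
      ultimately show "ennreal r < set_distance d U V" by (rule order.strict_trans2[rotated])
    qed
  qed
  moreover have "T k \<subseteq> \<Union>(\<U> k)" for k
    by (auto simp: \<U>_def C_def)
  then have "M \<subseteq> (\<Union>k\<in>{0..n}. \<Union>(\<U> k))" using cover by (meson SUP_mono order_trans)
  ultimately show "\<exists>\<U> :: int \<Rightarrow> 'a set set.
        (\<forall>k\<in>{0..n}. \<U> k \<subseteq> Pow M \<and> uniformly_bounded_family d (\<U> k) \<and> r_disjoint_family d r (\<U> k)) \<and>
        M \<subseteq> (\<Union>k\<in>{0..n}. \<Union>(\<U> k))"
    by (intro exI[of _ \<U>] conjI ballI) simp_all
qed

text \<open>Each \<open>T k\<close> is the union of a family: a step of length at most r cannot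
  leave a member of an r-disjoint family, so a chain stays in one member.\<close>

lemma asdim_leD:
  assumes "asdim_le M d n" "r > 0"
  obtains T B where "M \<subseteq> (\<Union>k\<in>{0..n}. T k)" "\<And>k. k \<in> {0..n} \<Longrightarrow> T k \<subseteq> M"
    "\<And>k. k \<in> {0..n} \<Longrightarrow> chain_bounded d r B (T k)"
proof -
  obtain \<U> :: "int \<Rightarrow> 'a set set" where \<U>: "\<forall>k\<in>{0..n}. \<U> k \<subseteq> Pow M \<and>
      uniformly_bounded_family d (\<U> k) \<and> r_disjoint_family d r (\<U> k)"
    and cover: "M \<subseteq> (\<Union>k\<in>{0..n}. \<Union>(\<U> k))"
    using assms(1)[unfolded asdim_le_def, rule_format, OF assms(2)] by (elim exE conjE)
  have "\<exists>K. \<forall>k\<in>{0..n}. K k > 0 \<and> (\<forall>U\<in>\<U> k. set_diam d U \<le> ennreal (K k))"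
    using \<U> unfolding uniformly_bounded_family_def by (intro bchoice) blast
  then obtain K where K: "\<And>k. k \<in> {0..n} \<Longrightarrow> K k > 0 \<and> (\<forall>U\<in>\<U> k. set_diam d U \<le> ennreal (K k))"
    by blast
  define B where "B = (\<Sum>k\<in>{0..n}. K k)"
  show ?thesis
  proof (rule that[of "\<lambda>k. \<Union>(\<U> k)" B])
    show "M \<subseteq> (\<Union>k\<in>{0..n}. \<Union>(\<U> k))" by (rule cover)
    show "\<Union>(\<U> k) \<subseteq> M" if "k \<in> {0..n}" for k using \<U> that by blast
    show "chain_bounded d r B (\<Union>(\<U> k))" if k: "k \<in> {0..n}" for k
      unfolding chain_bounded_def
    proof (intro ballI allI impI)
      fix x y assume "x \<in> \<Union>(\<U> k)" and xy: "(x, y) \<in> (chain_rel d r (\<Union>(\<U> k)))\<^sup>*"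
      then obtain U where U: "x \<in> U" "U \<in> \<U> k" by blast
      have "y \<in> U" using xy
      proof (induction rule: rtrancl_induct)
        case (step y z)
        obtain V where V: "z \<in> V" "V \<in> \<U> k" using step.hyps(2) by (auto simp: chain_rel_def)
        have "V = U"
        proof (rule ccontr)
          assume "V \<noteq> U"
          then have "ennreal r < set_distance d U V"
            using bspec[OF \<U> k] U V unfolding r_disjoint_family_def by blast
          also have "\<dots> \<le> ennreal (d y z)"
            unfolding set_distance_def by (rule INF_lower2[of "(y, z)"]) (use step.IH V in auto)
          also have "\<dots> \<le> ennreal r" using step.hyps(2) by (auto simp: chain_rel_def intro: ennreal_leI)
          finally show False by simp
        qed
        then show ?case using V by simp
      qed (use U in simp)
      then have "ennreal (d x y) \<le> set_diam d U"
        unfolding set_diam_def by (intro SUP_upper2[of "(x, y)"]) (use U in auto)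
      also have "\<dots> \<le> ennreal (K k)" using K[OF k] U by blast
      finally have "d x y \<le> K k" using K[OF k] by (simp add: ennreal_le_iff)
      also have "K k \<le> B" unfolding B_def using K k by (intro member_le_sum) (auto intro: less_imp_le)
      finally show "d x y \<le> B" .
    qed
  qed
qed

end

sublocale busemann_plane \<subseteq> metric: Metric_space UNIV d
  by standard (auto simp: nonneg zero commute triangle)

text \<open>Lets colors modulo k separate integer levels: close points have levels less than k
  apart, so along a monochromatic chain the level is constant.\<close>

lemma eq_if_close_if_mod_eq:
  fixes a b k :: nat
  assumes "a < b + k" "b < a + k" "a mod k = b mod k"
  shows "a = b"
proof (cases a b rule: le_cases)
  case le
  then have "k dvd b - a" using assms(3) mod_eq_dvd_iff_nat[of a b k] by simp
  then show ?thesis using assms(2) le by (auto dest: dvd_imp_le)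
next
  case ge
  then have "k dvd a - b" using assms(3) mod_eq_dvd_iff_nat[of b a k] by simp
  then show ?thesis using assms(1) ge by (auto dest: dvd_imp_le)
qed

context busemann_plane
begin

section \<open>Spheres\<close>

definition sph :: "real \<Rightarrow> complex set" where
  "sph a = {v. d 0 v = a}"

text \<open>The point p is at distance a - \<open>d 0 p\<close> from u, and no point of the sphere
  is nearer to p. So \<open>d p u \<le> d p v'\<close>, and going from u to v through p is no longer
  than \<open>[v, v']\<close>.\<close>

lemma dist_le_if_crossing:
  assumes "v \<in> sph a" "v' \<in> sph a" "u \<in> sph a" "p \<in> seg v v'" "p \<in> seg 0 u"
  shows "d u v \<le> d v v'"
proof -
  obtain s t where s: "s \<in> {0..1}" "p = G v v' s" and t: "t \<in> {0..1}" "p = G 0 u t"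
    using assms(4,5) unfolding seg_def by blast
  have "d v p + d p v' = d v v'"
    using dist_G_left[OF s(1), of v v'] dist_G_right[OF s(1), of v v'] s(2) by (simp add: algebra_simps)
  moreover have "d 0 p + d p u = a"
    using dist_G_left[OF t(1), of 0 u] dist_G_right[OF t(1), of 0 u] t(2) assms(3)
    by (simp add: algebra_simps sph_def)
  moreover have "a \<le> d 0 p + d p v'" using triangle[of 0 v' p] assms(2) by (simp add: sph_def)
  moreover have "d u v \<le> d u p + d p v" by (rule triangle)
  ultimately show ?thesis using commute[of u p] commute[of v p] by linarith
qed

text \<open>Inserting \<open>f 0\<close> covers paths of length 0, for which the union is
  empty.\<close>

lemma connected_polygon:
  fixes f :: "nat \<Rightarrow> complex"
  shows "connected (insert (f 0) (\<Union>i<k. seg (f i) (f (Suc i))))" (is "connected (?Z k)")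
    and "f k \<in> insert (f 0) (\<Union>i<k. seg (f i) (f (Suc i)))"
proof (induction k)
  case (Suc k)
  {
    case 1
    have "?Z (Suc k) = ?Z k \<union> seg (f k) (f (Suc k))" by (auto simp: lessThan_Suc)
    moreover have "connected (?Z k \<union> seg (f k) (f (Suc k)))"
      using Suc connected_seg ends_in_seg(1)[of "f k" "f (Suc k)"] by (intro connected_Un) auto
    ultimately show ?case by simp
  next
    case 2
    show ?case using ends_in_seg(2)[of "f (Suc k)" "f k"] by auto
  }
qed auto

text \<open>In the graph on a sphere in which points at distance at most \<open>D\<close> are adjacent, root every
  component and take the points at even and at odd graph distance from the root. By
  \<open>no_claw\<close>, three points of the same level which are far apart cannot lie in one coarse
  component: the radial geodesic to one of them would have to cross a shortest path to another.\<close>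

lemma sphere_two_coloring:
  assumes D: "D \<ge> 0"
  obtains e :: "complex \<Rightarrow> nat" where "\<And>v. e v < 2"
    "\<And>i. chain_bounded d D (5 * D) {v \<in> sph a. e v = i}"
proof -
  define E where "E = chain_rel d D (sph a)"
  have symE: "sym E" unfolding E_def by (rule metric.sym_chain_rel)
  obtain root where root: "\<And>x. (x, root x) \<in> E\<^sup>*"
    and root_eq: "\<And>x y. (x, y) \<in> E\<^sup>* \<Longrightarrow> root x = root y"
    using component_representative[OF symE] by blast
  define level where "level x = (LEAST n. (root x, x) \<in> E ^^ n)" for x
  have level: "(root x, x) \<in> E ^^ level x" for x
  proof -
    have "(root x, x) \<in> E\<^sup>*" using root sym_rtrancl[OF symE] by (meson symD)
    then obtain n where "(root x, x) \<in> E ^^ n" by (metis rtrancl_power)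
    then show ?thesis unfolding level_def by (rule LeastI)
  qed
  have level_le: "level x \<le> n" if "(root x, x) \<in> E ^^ n" for x n
    unfolding level_def using that by (rule Least_le)
  have level_step: "level y \<le> Suc (level x)" if "(x, y) \<in> E" for x y
  proof (rule level_le)
    have "root y = root x" using root_eq[OF r_into_rtrancl[OF that]] by simp
    then show "(root y, y) \<in> E ^^ Suc (level x)" using level[of x] that by auto
  qed
  have symE1: "(y, x) \<in> E" if "(x, y) \<in> E" for x y
    using symE that by (rule symD)
  \<comment> \<open>The leg Z is the geodesic polygon along a shortest path from the root to
    p.\<close>
  have leg: "\<exists>Z. connected Z \<and> Z \<subseteq> {v. d 0 v \<le> a} \<and> root p \<in> Z \<and> p \<in> Z \<and>
      (\<forall>q\<in>sph a. root q = root p \<and> level q = level p \<and> d q p > 2 * D \<longrightarrow> Z \<inter> seg 0 q = {})"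
    if p: "p \<in> sph a" for p
  proof -
    obtain f where f: "f 0 = root p" "f (level p) = p"
      "\<And>i. i < level p \<Longrightarrow> (f i, f (Suc i)) \<in> E"
      using level[of p] unfolding relpow_fun_conv by blast
    have fS: "f i \<in> sph a" if "i \<le> level p" for i
    proof (cases "i = level p")
      case False
      then show ?thesis using f(3)[of i] that by (auto simp: E_def chain_rel_def)
    qed (use f p in simp)
    have pow: "(root p, f i) \<in> E ^^ i" if "i \<le> level p" for i
      unfolding relpow_fun_conv using f that by (intro exI[of _ f]) auto
    \<comment> \<open>If q is adjacent to vertex i of the shortest path, its level is at most i + 1.
      Having the level of p, it can only be adjacent to the last two vertices, both within D of
      p.\<close>
    have adj: "d q p \<le> 2 * D"
      if q: "q \<in> sph a" "root q = root p" "level q = level p" and i: "i \<le> level p" "d q (f i) \<le> D" for q i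
    proof -
      have "(f i, q) \<in> E" using q fS[OF i(1)] i(2) commute[of q "f i"] by (simp add: E_def chain_rel_def)
      then have "(root q, q) \<in> E ^^ Suc i" using pow[OF i(1)] q by auto
      then have "level p \<le> Suc i" using level_le q by metis
      then consider "i = level p" | "level p = Suc i" using i by linarith
      then show ?thesis
      proof cases
        case 1
        then show ?thesis using i f D by simp
      next
        case 2
        then have "d (f i) p \<le> D" using f(2) f(3)[of i] by (simp add: E_def chain_rel_def)
        then show ?thesis using triangle[of q p "f i"] i by simp
      qed
    qed
    define Z where "Z = insert (f 0) (\<Union>i<level p. seg (f i) (f (Suc i)))"
    have "Z \<inter> seg 0 q = {}"
      if q: "q \<in> sph a" "root q = root p" "level q = level p" "d q p > 2 * D" for q
    proof (rule ccontr)
      assume "Z \<inter> seg 0 q \<noteq> {}"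
      then obtain w where w: "w \<in> Z" "w \<in> seg 0 q" by blast
      have far: "\<not> d q (f i) \<le> D" if "i \<le> level p" for i
        using adj[OF q(1-3) that] q(4) by fastforce
      from w(1) consider "w = f 0" | i where "i < level p" "w \<in> seg (f i) (f (Suc i))"
        unfolding Z_def by blast
      then show False
      proof cases
        \<comment> \<open>The single vertex is treated as a degenerate segment.\<close>
        case 1
        then have "w \<in> seg (f 0) (f 0)" using ends_in_seg by simp
        then have "d q (f 0) \<le> d (f 0) (f 0)"
          using dist_le_if_crossing[OF _ _ q(1) _ w(2)] fS[of 0] by blast
        then show False using far[of 0] D by simp
      next
        case 2
        then have "d q (f i) \<le> d (f i) (f (Suc i))"
          using dist_le_if_crossing[OF fS fS q(1) _ w(2), of i "Suc i"] by simp
        then show False using far[of i] f(3)[OF 2(1)] 2(1) by (simp add: E_def chain_rel_def)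
      qed
    qed
    moreover have "connected Z" "p \<in> Z" "root p \<in> Z"
      using connected_polygon[of f "level p"] f unfolding Z_def by simp_all
    moreover have "Z \<subseteq> {v. d 0 v \<le> a}"
    proof -
      have "seg (f i) (f (Suc i)) \<subseteq> {v. d 0 v \<le> a}" if "i < level p" for i
        using dist_G_le_bound[of _ 0 "f i" a "f (Suc i)"] fS[of i] fS[of "Suc i"] that
        by (auto simp: seg_def sph_def)
      then show ?thesis using fS[of 0] by (auto simp: Z_def sph_def)
    qed
    ultimately show ?thesis by blast
  qed
  define T where "T i = {v \<in> sph a. level v mod 2 = i}" for i
  \<comment> \<open>Levels of adjacent points differ by at most one, so equal parity forces
    equality.\<close>
  have same: "root y = root x \<and> level y = level x" if "(x, y) \<in> (chain_rel d D (T i))\<^sup>*" for x y i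
    using that
  proof (induction rule: rtrancl_induct)
    case (step y z)
    then have yz: "(y, z) \<in> E" "level y mod 2 = level z mod 2" by (auto simp: T_def E_def chain_rel_def)
    have "root y = root z" using root_eq[OF r_into_rtrancl[OF yz(1)]] by simp
    moreover have "level z < level y + 2" "level y < level z + 2"
      using level_step[OF yz(1)] level_step[OF symE1[OF yz(1)]] by simp_all
    then have "level z = level y" by (rule eq_if_close_if_mod_eq[OF _ _ yz(2)[symmetric]])
    ultimately show ?case using step.IH by simp
  qed simp
  have "chain_bounded d D (5 * D) (T i)" for i
    unfolding chain_bounded_def
  proof (intro ballI allI impI, rule ccontr)
    fix x y assume x: "x \<in> T i" and xy: "(x, y) \<in> (chain_rel d D (T i))\<^sup>*" and "\<not> d x y \<le> 5 * D"
    then have far: "5 * D < d x y" by simp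
    \<comment> \<open>Origin of 5 D: w is between 2 D and 3 D away from x, and more than 2 D must
      remain to y. The claw has center \<open>root x\<close> and ends x, y, w.\<close>
    obtain w where w: "(x, w) \<in> (chain_rel d D (T i))\<^sup>*" "2 * D < d x w" "d x w \<le> 2 * D + D"
      using metric.chain_intermediate[OF xy x, of "2 * D"] D far by auto
    have wy: "2 * D < d w y" using triangle[of x y w] far w(3) by simp
    define P where "P = (\<lambda>j::nat. if j = 0 then x else if j = 1 then y else w)"
    have P: "P j \<in> sph a" "root (P j) = root x" "level (P j) = level x" for j
      using x chain_rtrancl_in[OF xy x] chain_rtrancl_in[OF w(1) x] same[OF xy] same[OF w(1)]
      by (auto simp: P_def T_def)
    have dP: "2 * D < d (P j) (P k)" if "j < 3" "k < 3" "j \<noteq> k" for j k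
      using that far w(2) wy commute[of y x] commute[of w x] commute[of y w] D unfolding P_def by auto
    obtain Z where Z: "\<And>j. connected (Z j)" "\<And>j. Z j \<subseteq> {v. d 0 v \<le> a}" "\<And>j. root x \<in> Z j"
      "\<And>j. P j \<in> Z j"
      "\<And>j q. \<lbrakk>q \<in> sph a; root q = root (P j); level q = level (P j); d q (P j) > 2 * D\<rbrakk> \<Longrightarrow> Z j \<inter> seg 0 q = {}"
    proof -
      have "\<exists>Z. \<forall>j. connected (Z j) \<and> Z j \<subseteq> {v. d 0 v \<le> a} \<and> root (P j) \<in> Z j \<and> P j \<in> Z j \<and>
        (\<forall>q\<in>sph a. root q = root (P j) \<and> level q = level (P j) \<and> d q (P j) > 2 * D \<longrightarrow> Z j \<inter> seg 0 q = {})"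
        by (intro choice allI leg P)
      then show ?thesis using that P(2) by metis
    qed
    show False
    proof (rule no_claw[of P a Z "root x"])
      show "d 0 (P j) = a" for j using P(1)[of j] by (simp add: sph_def)
      show "P j \<noteq> P k" if "j < 3" "k < 3" "j \<noteq> k" for j k using dP[OF that] D by auto
      show "Z j \<inter> seg 0 (P k) = {}" if "j < 3" "k < 3" "j \<noteq> k" for j k
        by (rule Z(5)) (use P dP[of k j] that in auto)
    qed (use Z in auto)
  qed
  then show ?thesis
    using that[of "\<lambda>v. level v mod 2"] unfolding T_def by simp
qed

section \<open>Annuli and the upper bound\<close>

text \<open>Radial projection to the sphere of radius s. At v = 0 the convention s / 0 = 0 gives the
  value 0.\<close>

definition proj :: "real \<Rightarrow> complex \<Rightarrow> complex" where
  "proj s v = G 0 v (s / d 0 v)"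

lemma dist_0_proj:
  assumes "0 \<le> s" "s \<le> d 0 v"
  shows "d 0 (proj s v) = s" "d (proj s v) v = d 0 v - s"
proof -
  have t: "s / d 0 v \<in> {0..1}" using assms nonneg[of 0 v] by (auto simp: divide_le_eq_1)
  have eq: "s / d 0 v * d 0 v = s" using assms by (cases "d 0 v = 0") auto
  show "d 0 (proj s v) = s" using dist_G_left[OF t, of 0 v] unfolding proj_def eq .
  show "d (proj s v) v = d 0 v - s"
    using dist_G_right[OF t, of 0 v] unfolding proj_def left_diff_distrib eq by simp
qed

text \<open>Let u be the point nearer to 0. Cutting the geodesic to v at radius \<open>d 0 u\<close>
  moves v by at most \<open>d u v\<close>, which accounts for the factor 2; from equal radii,
  convexity makes the projection contracting.\<close>

lemma proj_lipschitz:
  assumes s: "0 \<le> s" "s \<le> d 0 u" "s \<le> d 0 v"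
  shows "d (proj s u) (proj s v) \<le> 2 * d u v"
proof -
  have *: "d (proj s u) (proj s v) \<le> 2 * d u v" if le: "d 0 u \<le> d 0 v" and su: "s \<le> d 0 u" for u v
  proof (cases "d 0 u = 0")
    case True
    then have "s = 0" using s su by simp
    then show ?thesis using nonneg[of u v] by (simp add: proj_def G_0)
  next
    case False
    then have pos: "d 0 u > 0" using nonneg[of 0 u] by simp
    define t where "t = d 0 u / d 0 v"
    have pos': "d 0 v > 0" using pos le by linarith
    have t: "t \<in> {0..1}" "t * d 0 v = d 0 u"
      unfolding t_def using pos pos' le by (simp_all del: metric.mdist_zero)
    have r: "s / d 0 u \<in> {0..1}" using pos s su by simp
    have "s / d 0 u * t = s / d 0 v" using pos by (simp add: t_def)
    then have "G 0 (G 0 v t) (s / d 0 u) = proj s v"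
      using G_initial[OF r t(1), of 0 v] by (simp add: proj_def)
    then have "d (proj s u) (proj s v) \<le> s / d 0 u * d u (G 0 v t)"
      using G_convex[OF r, of 0 u "G 0 v t"] by (simp add: proj_def)
    also have "\<dots> \<le> d u (G 0 v t)"
      by (intro mult_left_le_one_le) (use r nonneg in simp_all)
    also have "\<dots> \<le> d u v + d v (G 0 v t)" by (rule triangle)
    also have "d v (G 0 v t) = d 0 v - d 0 u"
      using dist_G_right[OF t(1), of 0 v] t(2) commute[of v "G 0 v t"] by (simp add: algebra_simps)
    also have "\<dots> \<le> d u v" using triangle[of 0 v u] by simp
    finally show ?thesis by simp
  qed
  show ?thesis
    using *[of u v] *[of v u] s commute[of "proj s u"] commute[of u v] by (cases "d 0 u \<le> d 0 v") auto
qed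

text \<open>Colors are pulled back from the inner sphere. Projection turns D-steps into 2 D-steps,
  so 5 times 2 D bounds the projected chain, and each end is within l of its projection.\<close>

lemma annulus_two_coloring:
  assumes D: "D \<ge> 0" and s: "s \<ge> 0"
  obtains e :: "complex \<Rightarrow> nat" where "\<And>v. e v < 2"
    "\<And>i. chain_bounded d D (10 * D + 2 * l) {v. s \<le> d 0 v \<and> d 0 v < s + l \<and> e v = i}"
proof -
  obtain e :: "complex \<Rightarrow> nat" where e: "\<And>v. e v < 2"
    "\<And>i. chain_bounded d (2 * D) (5 * (2 * D)) {v \<in> sph s. e v = i}"
    using sphere_two_coloring[of "2 * D" s] D by auto
  show ?thesis
  proof (rule that[of "\<lambda>v. e (proj s v)"])
    show "chain_bounded d D (10 * D + 2 * l) {v. s \<le> d 0 v \<and> d 0 v < s + l \<and> e (proj s v) = i}"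
      (is "chain_bounded d D _ ?A") for i
      unfolding chain_bounded_def
    proof (intro ballI allI impI)
      fix x y assume x: "x \<in> ?A" and xy: "(x, y) \<in> (chain_rel d D ?A)\<^sup>*"
      have y: "y \<in> ?A" using chain_rtrancl_in[OF xy x] .
      have sph: "proj s v \<in> sph s" if "v \<in> ?A" for v
        using that dist_0_proj[OF s] by (auto simp: sph_def)
      have "(proj s x, proj s y) \<in> (chain_rel d (2 * D) {v \<in> sph s. e v = i})\<^sup>*"
      proof (rule chain_rtrancl_map[OF xy])
        fix u v assume uv: "u \<in> ?A" "v \<in> ?A" "d u v \<le> D"
        then show "proj s u \<in> {v \<in> sph s. e v = i} \<and> proj s v \<in> {v \<in> sph s. e v = i} \<and>
            d (proj s u) (proj s v) \<le> 2 * D"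
          using proj_lipschitz[OF s, of u v] sph[OF uv(1)] sph[OF uv(2)] by auto
      qed
      then have "d (proj s x) (proj s y) \<le> 10 * D"
        using e(2)[of i] sph[OF x] x unfolding chain_bounded_def by auto
      moreover have "d (proj s x) x \<le> l" "d (proj s y) y \<le> l"
        using dist_0_proj(2)[OF s, of x] dist_0_proj(2)[OF s, of y] x y by auto
      ultimately show "d x y \<le> 10 * D + 2 * l"
        using triangle[of x y "proj s x"] triangle[of "proj s x" y "proj s y"]
          commute[of x "proj s x"] by simp
    qed
  qed (use e in simp)
qed

text \<open>The annulus number \<open>m\<close> uses the two colors \<open>m\<close> and \<open>m + 1\<close> modulo \<open>3\<close>. Monochromatic
  pieces of adjacent annuli can merge, but since the odd annuli are decomposed at a larger scale
  than the even ones, the pieces of the odd annuli merely absorb nearby pieces of the even ones.\<close>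

lemma asdim_le_2: "asdim_le UNIV d 2"
proof (rule metric.asdim_leI)
  fix r :: real assume r: "r > 0"
  \<comment> \<open>Width l > r lets a step change the annulus number by at most one. K bounds the
    pieces of even annuli at scale r; D is the scale that \<open>chain_bounded_Un\<close> then
    demands of the odd annuli, and K' bounds their pieces.\<close>
  define l where "l = 2 * r"
  define K where "K = 10 * r + 2 * l"
  define D where "D = K + 2 * r"
  define K' where "K' = 10 * D + 2 * l"
  define sc where "sc m = (if even m then r else D)" for m :: nat
  have pos: "l > 0" "K \<ge> 0" "D \<ge> 0" "K' \<ge> 0" using r by (auto simp: l_def K_def D_def K'_def)
  have "\<forall>m. \<exists>e :: complex \<Rightarrow> nat. (\<forall>v. e v < 2) \<and>
      (\<forall>i. chain_bounded d (sc m) (10 * sc m + 2 * l) {v. m * l \<le> d 0 v \<and> d 0 v < m * l + l \<and> e v = i})"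
  proof
    fix m :: nat
    have "sc m \<ge> 0" "m * l \<ge> 0" using r pos by (auto simp: sc_def)
    then obtain e :: "complex \<Rightarrow> nat" where "\<And>v. e v < 2"
      "\<And>i. chain_bounded d (sc m) (10 * sc m + 2 * l) {v. m * l \<le> d 0 v \<and> d 0 v < m * l + l \<and> e v = i}"
      by (rule annulus_two_coloring) blast
    then show "\<exists>e :: complex \<Rightarrow> nat. (\<forall>v. e v < 2) \<and>
      (\<forall>i. chain_bounded d (sc m) (10 * sc m + 2 * l) {v. m * l \<le> d 0 v \<and> d 0 v < m * l + l \<and> e v = i})"
      by blast
  qed
  from choice[OF this] obtain e :: "nat \<Rightarrow> complex \<Rightarrow> nat" where e: "\<And>m v. e m v < 2"
    "\<And>m i. chain_bounded d (sc m) (10 * sc m + 2 * l) {v. m * l \<le> d 0 v \<and> d 0 v < m * l + l \<and> e m v = i}"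
    by blast
  define n where "n v = nat \<lfloor>d 0 v / l\<rfloor>" for v
  have n_iff: "n v = m \<longleftrightarrow> m * l \<le> d 0 v \<and> d 0 v < m * l + l" for v m
  proof -
    have "n v = m \<longleftrightarrow> \<lfloor>d 0 v / l\<rfloor> = int m"
      using nonneg[of 0 v] pos by (auto simp: n_def)
    also have "\<dots> \<longleftrightarrow> m * l \<le> d 0 v \<and> d 0 v < m * l + l"
      using pos by (simp add: floor_eq_iff field_simps)
    finally show ?thesis .
  qed
  \<comment> \<open>The color before reduction modulo 3. The value j occurs only in annulus j with e
    = 0 and in annulus j - 1 with e = 1.\<close>
  define J where "J v = n v + e (n v) v" for v
  have n_step: "n v \<le> Suc (n u)" if "d u v \<le> r" for u v
  proof -
    have "d 0 v < n u * l + l + r" using triangle[of 0 v u] that n_iff[of u "n u"] by auto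
    then have "n v * l < (n u + 2) * l" using n_iff[of v "n v"] r by (simp add: l_def algebra_simps)
    then have "real (n v) < real (n u + 2)" using pos by (simp add: mult_less_cancel_right)
    then show ?thesis by linarith
  qed
  define A where "A m i = {v. n v = m \<and> e m v = i}" for m i
  have A: "chain_bounded d (sc m) (10 * sc m + 2 * l) (A m i)" for m i
    using e(2)[of m i] by (simp add: A_def n_iff)
  have even_A: "chain_bounded d r K (A m i)" if "even m" for m i
    using A[of m i] that by (simp add: sc_def K_def)
  have odd_A: "chain_bounded d D K' (A m i)" if "odd m" for m i
    using A[of m i] that by (simp add: sc_def K'_def)
  define B where "B = 2 * (K' + r + K)"
  have J_bounded: "chain_bounded d r B {v. J v = j}" for j
  proof (cases j)
    case 0
    then have "{v. J v = j} \<subseteq> A 0 0" by (auto simp: J_def A_def)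
    then show ?thesis
      by (rule chain_bounded_mono[OF even_A, rotated]) (use pos r in \<open>auto simp: B_def\<close>)
  next
    case (Suc k)
    have sub: "{v. J v = j} \<subseteq> A j 0 \<union> A k 1"
    proof
      fix v assume "v \<in> {v. J v = j}"
      moreover have "e (n v) v = 0 \<or> e (n v) v = 1" using e(1)[of "n v" v] by linarith
      ultimately show "v \<in> A j 0 \<union> A k 1" by (auto simp: J_def A_def Suc)
    qed
    have "\<exists>P Q. P \<union> Q = A j 0 \<union> A k 1 \<and> chain_bounded d r K P \<and> chain_bounded d D K' Q"
    proof (cases "even j")
      case True
      then have "odd k" using Suc by simp
      then show ?thesis using even_A[OF True] odd_A by blast
    next
      case False
      then have "even k" using Suc by simp
      then show ?thesis using odd_A[OF False] even_A by blast
    qed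
    then obtain P Q where PQ: "P \<union> Q = A j 0 \<union> A k 1" "chain_bounded d r K P"
      "chain_bounded d (K + 2 * r) K' Q" unfolding D_def by blast
    have "chain_bounded d r B (P \<union> Q)"
      unfolding B_def by (rule metric.chain_bounded_Un) (use PQ pos r in auto)
    then show ?thesis by (rule chain_bounded_mono) (use sub PQ in auto)
  qed
  define T where "T c = {v. int (J v mod 3) = c}" for c
  have T_bounded: "chain_bounded d r B (T c)" for c
    unfolding chain_bounded_def
  proof (intro ballI allI impI)
    fix x y assume x: "x \<in> T c" and xy: "(x, y) \<in> (chain_rel d r (T c))\<^sup>*"
    have "(x, y) \<in> (chain_rel d r {v. J v = J x})\<^sup>* \<and> J y = J x"
      using xy
    proof (induction rule: rtrancl_induct)
      case (step y z)
      then have yz: "d y z \<le> r" "J y mod 3 = J z mod 3" by (auto simp: T_def chain_rel_def)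
      have "n z \<le> Suc (n y)" "n y \<le> Suc (n z)"
        using n_step[of y z] n_step[of z y] yz(1) commute[of y z] by auto
      \<comment> \<open>Both summands of J change by at most one, so J changes by at most two and
        three colors separate its values.\<close>
      then have "J z < J y + 3" "J y < J z + 3"
        using e(1)[of "n y" y] e(1)[of "n z" z] by (auto simp: J_def)
      then have zy: "J z = J y" by (rule eq_if_close_if_mod_eq[OF _ _ yz(2)[symmetric]])
      have yx: "J y = J x" and xy: "(x, y) \<in> (chain_rel d r {v. J v = J x})\<^sup>*"
        using step.IH by (rule conjunct2, rule conjunct1)
      have zx: "J z = J x" using zy yx by (rule trans)
      have "(y, z) \<in> chain_rel d r {v. J v = J x}"
        unfolding chain_rel_def using yx zx yz(1) by blast
      with xy have "(x, z) \<in> (chain_rel d r {v. J v = J x})\<^sup>*" by (rule rtrancl_into_rtrancl)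
      then show ?case using zx by (rule conjI)
    qed simp
    then show "d x y \<le> B" using J_bounded[of "J x"] by (auto simp: chain_bounded_def)
  qed
  have "x \<in> (\<Union>k\<in>{0..2}. T k)" for x
    by (rule UN_I[of "int (J x mod 3)"]) (auto simp: T_def)
  then show "\<exists>T B. UNIV \<subseteq> (\<Union>k\<in>{0..2}. T k) \<and> (\<forall>k\<in>{0..2::int}. T k \<subseteq> UNIV \<and> chain_bounded d r B (T k))"
    using T_bounded by (intro exI[of _ T] exI[of _ B]) auto
qed

end

section \<open>The lower bound\<close>

context busemann_plane
begin

text \<open>Points of \<open>T\<close> closer than \<open>2/3\<close> lie in the same coarse component, so mapping a neighborhood of
  \<open>T\<close> to representatives of the components is locally constant.\<close>

lemma locally_constant_representatives:
  assumes T: "chain_bounded d 1 B T"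
  obtains c :: "complex \<Rightarrow> complex" and C where "\<And>x. c x \<noteq> 0"
    "\<And>x t. \<lbrakk>t \<in> T; d x t < 1/3\<rbrakk> \<Longrightarrow> d x (c x) \<le> C"
    "\<And>x t. \<lbrakk>t \<in> T; d x t < 1/3\<rbrakk> \<Longrightarrow> \<exists>V. open V \<and> x \<in> V \<and> (\<forall>y\<in>V. c y = c x)"
proof -
  obtain \<rho> where \<rho>: "\<And>x. (x, \<rho> x) \<in> (chain_rel d 1 T)\<^sup>*"
    "\<And>x y. (x, y) \<in> (chain_rel d 1 T)\<^sup>* \<Longrightarrow> \<rho> x = \<rho> y"
    using component_representative[OF metric.sym_chain_rel, of 1 T] by blast
  \<comment> \<open>A representative 0 is replaced by 1, so that no vertex of the graph is 0; this
    adds \<open>d 0 1\<close> to the displacement.\<close>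
  define \<phi> where "\<phi> t = (if \<rho> t = 0 then 1 else \<rho> t)" for t
  define c where "c x = \<phi> (SOME t. t \<in> T \<and> d x t < 1/3)" for x
  have c: "c x = \<phi> t" if t: "t \<in> T" "d x t < 1/3" for x t
  proof -
    define t' where "t' = (SOME t. t \<in> T \<and> d x t < 1/3)"
    have t': "t' \<in> T \<and> d x t' < 1/3" unfolding t'_def by (rule someI) (use t in blast)
    then have "d t' t \<le> 1" using triangle[of t' t x] t commute[of t' x] by simp
    then have "(t', t) \<in> chain_rel d 1 T" using t t' by (simp add: chain_rel_def)
    from \<rho>(2)[OF r_into_rtrancl[OF this]] have "\<phi> t' = \<phi> t" by (simp add: \<phi>_def)
    then show ?thesis by (simp only: c_def t'_def)
  qed
  show ?thesis
  proof (rule that[of c "B + 1 + d 0 1"])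
    show "c x \<noteq> 0" for x by (simp add: c_def \<phi>_def)
    fix x t assume t: "t \<in> T" "d x t < 1/3"
    have tB: "d t (\<rho> t) \<le> B" using T t(1) \<rho>(1) unfolding chain_bounded_def by blast
    have n: "0 \<le> d 0 1" by (rule nonneg)
    have "d t (\<phi> t) \<le> B + d 0 1"
    proof (cases "\<rho> t = 0")
      case True
      then show ?thesis using triangle[of t 1 0] tB by (simp add: \<phi>_def)
    next
      case False
      then show ?thesis unfolding \<phi>_def using tB n by (simp only: if_False)
    qed
    then show "d x (c x) \<le> B + 1 + d 0 1"
      using triangle[of x "\<phi> t" t] t(2) unfolding c[OF t] by linarith
    show "\<exists>V. open V \<and> x \<in> V \<and> (\<forall>y\<in>V. c y = c x)"
    proof (intro exI[of _ "{y. d t y < 1/3}"] conjI ballI)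
      show "open {y. d t y < 1/3}" by (rule open_ball)
      show "x \<in> {y. d t y < 1/3}" using t(2) commute[of t x] by simp
      fix y assume "y \<in> {y. d t y < 1/3}"
      then have "d y t < 1/3" using commute[of t y] by simp
      then show "c y = c x" using c[OF t] c[OF t(1)] by simp
    qed
  qed
qed

text \<open>Supplies the edges of the graph. The geodesic is kept whenever it misses 0, since it
  controls displacement; a detour of unknown size is taken otherwise.\<close>

lemma path_avoiding_0:
  assumes "u \<noteq> 0" "v \<noteq> 0"
  obtains p where "continuous_on {0..1} p" "p 0 = u" "p 1 = v" "\<And>s. s \<in> {0..1} \<Longrightarrow> p s \<noteq> 0"
    "0 \<notin> seg u v \<Longrightarrow> p = G u v"
proof (cases "0 \<in> seg u v")
  case True
  have "path_connected (-{0::complex})" by (rule path_connected_punctured_universe) simp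
  then obtain g where g: "path g" "path_image g \<subseteq> -{0}" "pathstart g = u" "pathfinish g = v"
    using assms unfolding path_connected_def by blast
  have "g s \<noteq> 0" if "s \<in> {0..1}" for s using g(2) that by (auto simp: path_image_def)
  with g True show ?thesis
    by (intro that[of g]) (auto simp: path_def pathstart_def pathfinish_def)
next
  case False
  show ?thesis
  proof (rule that[of "G u v"])
    show "continuous_on {0..1} (G u v)" by (intro continuous_intros) auto
    show "G u v s \<noteq> 0" if "s \<in> {0..1}" for s using False that by (force simp: seg_def)
  qed (auto simp: G_0 G_1)
qed

text \<open>Displacement is bounded only far from 0, which leaves room for detours of edges around
  0. A zero-free F has a logarithm on the whole plane, and on a large circle the geodesics from v to
  \<open>F v\<close> are too short to reach 0.\<close>

lemma continuous_map_bounded_displacement_hits_0: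
  assumes F: "continuous_on UNIV F" and disp: "\<And>x. C < d 0 x \<Longrightarrow> d x (F x) \<le> C"
  shows "\<exists>x. F x = 0"
proof (rule ccontr)
  assume "\<nexists>x. F x = 0"
  then obtain g where g: "continuous_on UNIV g" "\<And>x. F x = exp (g x)"
    using continuous_logarithm_on_contractible[OF F contractible_UNIV] by auto
  obtain R where R: "R > 0" "{v. d 0 v \<le> C} \<subseteq> ball 0 R" by (rule ball_subset_euclidean_ball)
  have far: "C < d 0 v" if "v \<in> sphere 0 R" for v
    using R(2) that by force
  have nz: "G v (F v) s \<noteq> 0" if "0 \<le> s" "s \<le> 1" "v \<in> sphere 0 R" for s v
  proof
    assume "G v (F v) s = 0"
    then have "d v 0 = s * d v (F v)" using dist_G_left[of s v "F v"] that by simp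
    also have "\<dots> \<le> d v (F v)"
      by (intro mult_left_le_one_le) (use that nonneg in auto)
    also have "\<dots> \<le> C" by (rule disp[OF far[OF that(3)]])
    finally show False using far[OF that(3)] commute[of v 0] by simp
  qed
  have contF: "continuous_on S F" for S using F by (rule continuous_on_subset) simp
  obtain h where "continuous_on (sphere 0 R) h" "\<And>v. v \<in> sphere 0 R \<Longrightarrow> exp (h v) = G v (F v) 0"
  proof (rule continuous_logarithm_homotopy[of "sphere 0 R" "\<lambda>s v. G v (F v) s" g])
    show "continuous_on ({0..1} \<times> sphere 0 R) (\<lambda>(s, v). G v (F v) s)"
      unfolding case_prod_unfold
      by (intro continuous_intros continuous_on_compose2[OF contF[of UNIV]]) auto
    show "continuous_on (sphere 0 R) g" by (rule continuous_on_subset[OF g(1)]) simp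
    show "exp (g v) = G v (F v) 1" for v using g(2)[of v] by (simp add: G_1)
  qed (use nz in auto)
  then show False using no_continuous_logarithm_on_circle[of 0 R h] R(1) by (simp add: G_0)
qed

text \<open>A cover of dimension \<open>1\<close> yields a map which moves points by a bounded distance and
  factors through a graph. Choosing the edges of the graph outside \<open>0\<close>, the map misses \<open>0\<close>.\<close>

lemma not_asdim_le_1: "\<not> asdim_le UNIV d 1"
proof
  assume "asdim_le UNIV d 1"
  then obtain T :: "int \<Rightarrow> complex set" and B where cover: "UNIV \<subseteq> (\<Union>k\<in>{0..1}. T k)"
    and T: "\<And>k. k \<in> {0..1} \<Longrightarrow> chain_bounded d 1 B (T k)"
    by (rule metric.asdim_leD[of 1 1]) auto
  have cover: "x \<in> T 0 \<or> x \<in> T 1" for x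
  proof -
    obtain k :: int where "k \<in> {0..1}" "x \<in> T k" using cover by blast
    moreover have "k = 0 \<or> k = 1" using \<open>k \<in> {0..1}\<close> by auto
    ultimately show ?thesis by auto
  qed
  obtain c0 C0 where c0: "\<And>x. c0 x \<noteq> 0"
    "\<And>x t. \<lbrakk>t \<in> T 0; d x t < 1/3\<rbrakk> \<Longrightarrow> d x (c0 x) \<le> C0"
    "\<And>x t. \<lbrakk>t \<in> T 0; d x t < 1/3\<rbrakk> \<Longrightarrow> \<exists>V. open V \<and> x \<in> V \<and> (\<forall>y\<in>V. c0 y = c0 x)"
    using locally_constant_representatives[OF T[of 0]] by auto
  obtain c1 C1 where c1: "\<And>x. c1 x \<noteq> 0"
    "\<And>x t. \<lbrakk>t \<in> T 1; d x t < 1/3\<rbrakk> \<Longrightarrow> d x (c1 x) \<le> C1"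
    "\<And>x t. \<lbrakk>t \<in> T 1; d x t < 1/3\<rbrakk> \<Longrightarrow> \<exists>V. open V \<and> x \<in> V \<and> (\<forall>y\<in>V. c1 y = c1 x)"
    using locally_constant_representatives[OF T[of 1]] by auto
  define C where "C = max C0 C1"
  define O0 where "O0 = (\<Union>t\<in>T 0. {x. d t x < 1/3})"
  have O0: "\<exists>t\<in>T 0. d x t < 1/3" if "x \<in> O0" for x
    using that by (auto simp: O0_def commute)
  have "closure (T 0) \<subseteq> O0"
  proof
    fix x assume "x \<in> closure (T 0)"
    moreover have "x \<in> {y. d x y < 1/3}" by simp
    ultimately have "{y. d x y < 1/3} \<inter> closure (T 0) \<noteq> {}" by blast
    then have "{y. d x y < 1/3} \<inter> T 0 \<noteq> {}"
      unfolding open_Int_closure_eq_empty[OF open_ball] .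
    then show "x \<in> O0" by (auto simp: O0_def commute)
  qed
  then have disj: "closure (T 0) \<inter> -O0 = {}" by blast
  have "open O0" unfolding O0_def by (intro open_UN ballI open_ball)
  then have "closed (-O0)" by (simp add: closed_Compl)
  from Urysohn_strong[OF closed_closure this disj zero_neq_one] obtain f :: "complex \<Rightarrow> real" where f: "continuous_on UNIV f"
    "\<And>x. f x \<in> closed_segment 0 1" "\<And>x. f x = 0 \<longleftrightarrow> x \<in> closure (T 0)" "\<And>x. f x = 1 \<longleftrightarrow> x \<in> -O0"
    by metis
  \<comment> \<open>The vertex map \<open>c0\<close> is controlled on \<open>O0\<close>, where f <
    1. Where f > 0 the point is outside \<open>T 0\<close>, hence in \<open>T 1\<close>, and
    \<open>c1\<close> is controlled.\<close>
  have loc0: "d x (c0 x) \<le> C \<and> (\<exists>V. open V \<and> x \<in> V \<and> (\<forall>y\<in>V. c0 y = c0 x))" if "f x < 1" for x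
  proof -
    have "x \<in> O0" using that f(4)[of x] by auto
    then obtain t where "t \<in> T 0" "d x t < 1/3" using O0 by blast
    then show ?thesis using c0(2,3)[of t x] by (simp add: C_def)
  qed
  have loc1: "d x (c1 x) \<le> C \<and> (\<exists>V. open V \<and> x \<in> V \<and> (\<forall>y\<in>V. c1 y = c1 x))" if "0 < f x" for x
  proof -
    have "x \<notin> T 0" using that f(3)[of x] closure_subset[of "T 0"] by auto
    then have "x \<in> T 1" using cover by blast
    then show ?thesis using c1(2,3)[of x x] by (simp add: C_def)
  qed
  have "\<forall>u v. \<exists>p. u \<noteq> 0 \<and> v \<noteq> 0 \<longrightarrow> continuous_on {0..1} p \<and> p 0 = u \<and> p 1 = v \<and>
      (\<forall>s\<in>{0..1}. p s \<noteq> 0) \<and> (0 \<notin> seg u v \<longrightarrow> p = G u v)"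
    using path_avoiding_0 by metis
  then obtain P where P: "\<And>u v. u \<noteq> 0 \<Longrightarrow> v \<noteq> 0 \<Longrightarrow> continuous_on {0..1} (P u v) \<and>
      P u v 0 = u \<and> P u v 1 = v \<and> (\<forall>s\<in>{0..1}. P u v s \<noteq> 0) \<and> (0 \<notin> seg u v \<longrightarrow> P u v = G u v)"
    by metis
  \<comment> \<open>Flattening f near its extreme values keeps F equal to one vertex map on a
    neighborhood of the points where the other one is uncontrolled.\<close>
  define \<tau> where "\<tau> x = max 0 (min 1 (3 * f x - 1))" for x
  have \<tau>: "\<tau> x \<in> {0..1}" "\<tau> x = 0 \<longleftrightarrow> f x \<le> 1/3" "\<tau> x = 1 \<longleftrightarrow> f x \<ge> 2/3" for x
    by (auto simp: \<tau>_def max_def min_def)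
  have cont\<tau>: "continuous_on V \<tau>" for V
    unfolding \<tau>_def by (intro continuous_intros continuous_on_subset[OF f(1)]) simp
  define F where "F x = (if \<tau> x = 0 then c0 x else if \<tau> x = 1 then c1 x else P (c0 x) (c1 x) (\<tau> x))" for x
  have F_P: "F x = P (c0 x) (c1 x) (\<tau> x)" for x
    using P[OF c0(1) c1(1), of x x] by (auto simp: F_def)
  have F0: "F y = c0 y" if "f y \<le> 1/3" for y
    using \<tau>(2)[of y] that by (simp add: F_def)
  have F1: "F y = c1 y" if "2/3 \<le> f y" for y
    using \<tau>(3)[of y] that by (simp add: F_def)
  have open_f: "open {y. f y < a}" "open {y. a < f y}" for a
    using f(1) by (auto intro!: open_Collect_less continuous_on_const)
  have "continuous_on UNIV F"
  proof (rule continuous_at_imp_continuous_on, rule ballI)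
    fix x
    have "\<exists>V. open V \<and> x \<in> V \<and> continuous_on V F"
    proof (cases "f x < 1/3")
      case True
      then obtain V where V: "open V" "x \<in> V" "\<forall>y\<in>V. c0 y = c0 x" using loc0[of x] by auto
      have "c0 x = F y" if "y \<in> V \<inter> {y. f y < 1/3}" for y
        using F0[of y] V(3) that by simp
      then have "continuous_on (V \<inter> {y. f y < 1/3}) F"
        by (rule continuous_on_eq[OF continuous_on_const])
      moreover have "open (V \<inter> {y. f y < 1/3})" by (intro open_Int V(1) open_f)
      moreover have "x \<in> V \<inter> {y. f y < 1/3}" using V(2) True by blast
      ultimately show ?thesis by blast
    next
      case f1: False
      then obtain V1 where V1: "open V1" "x \<in> V1" "\<forall>y\<in>V1. c1 y = c1 x" using loc1[of x] by auto
      show ?thesis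
      proof (cases "2/3 < f x")
        case True
        have "c1 x = F y" if "y \<in> V1 \<inter> {y. 2/3 < f y}" for y
          using F1[of y] V1(3) that by simp
        then have "continuous_on (V1 \<inter> {y. 2/3 < f y}) F"
          by (rule continuous_on_eq[OF continuous_on_const])
        moreover have "open (V1 \<inter> {y. 2/3 < f y})" by (intro open_Int V1(1) open_f)
        moreover have "x \<in> V1 \<inter> {y. 2/3 < f y}" using V1(2) True by blast
        ultimately show ?thesis by blast
      next
        case False
        then obtain V0 where V0: "open V0" "x \<in> V0" "\<forall>y\<in>V0. c0 y = c0 x" using loc0[of x] by auto
        have "continuous_on {0..1} (P (c0 x) (c1 x))" using P[OF c0(1) c1(1), of x x] by (rule conjunct1)
        then have "continuous_on (V0 \<inter> V1) (\<lambda>y. P (c0 x) (c1 x) (\<tau> y))"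
          by (rule continuous_on_compose2[OF _ cont\<tau>]) (use \<tau>(1) in blast)
        moreover have "P (c0 x) (c1 x) (\<tau> y) = F y" if "y \<in> V0 \<inter> V1" for y
          using V0(3) V1(3) that by (simp add: F_P)
        ultimately have "continuous_on (V0 \<inter> V1) F"
          by (rule continuous_on_eq)
        then show ?thesis using V0 V1 by (intro exI[of _ "V0 \<inter> V1"]) auto
      qed
    qed
    then show "isCont F x" using continuous_on_eq_continuous_at by blast
  qed
  moreover have "d x (F x) \<le> C" if far: "C < d 0 x" for x
  proof -
    consider "f x = 0" | "f x = 1" | "0 < f x" "f x < 1"
      using f(2)[of x] by (fastforce simp: closed_segment_eq_real_ivl)
    then show ?thesis
    proof cases
      case 1
      then show ?thesis using loc0[of x] F0[of x] by simp
    next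
      case 2
      then show ?thesis using loc1[of x] F1[of x] by simp
    next
      case 3
      \<comment> \<open>Balls are convex, so the geodesic edge stays within C of x. For x farther
        than C from 0 it misses 0, and \<open>P\<close> is this geodesic rather than a
        detour.\<close>
      have near: "d x (G (c0 x) (c1 x) s) \<le> C" if "s \<in> {0..1}" for s
        using dist_G_le_bound[OF that] loc0[of x] loc1[of x] 3 by blast
      have "0 \<notin> seg (c0 x) (c1 x)"
        using near far commute[of x 0] by (force simp: seg_def)
      then have "F x = G (c0 x) (c1 x) (\<tau> x)" using P[OF c0(1) c1(1), of x x] by (simp add: F_P)
      then show ?thesis using near[OF \<tau>(1)] by simp
    qed
  qed
  ultimately obtain x where "F x = 0" using continuous_map_bounded_displacement_hits_0[of F C] by blast
  then show False using P[OF c0(1) c1(1), of x x] \<tau>(1)[of x] by (simp add: F_P)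
qed

end

section \<open>CAT(0) spaces\<close>

lemma euclidean_triangle_exists:
  fixes a b c :: real
  assumes "0 \<le> a" "0 \<le> b" "0 \<le> c" "a \<le> b + c" "b \<le> a + c" "c \<le> a + b"
  obtains p q r :: "real^2" where "dist p q = c" "dist q r = a" "dist r p = b"
proof -
  \<comment> \<open>First coordinate of the third vertex by the law of cosines, with the side c on
    the axis. For c = 0 division yields 0, which fits since then a = b.\<close>
  define x where "x = (b\<^sup>2 + c\<^sup>2 - a\<^sup>2) / (2 * c)"
  have x: "x\<^sup>2 \<le> b\<^sup>2" "2 * c * x = b\<^sup>2 + c\<^sup>2 - a\<^sup>2"
  proof -
    have "c = 0 \<Longrightarrow> a = b" using assms by simp
    then show *: "2 * c * x = b\<^sup>2 + c\<^sup>2 - a\<^sup>2" by (cases "c = 0") (auto simp: x_def)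
    have "\<bar>x\<bar> \<le> b"
    proof (cases "c = 0")
      case True
      then show ?thesis using assms by (simp add: x_def)
    next
      case False
      then have c: "2 * c > 0" using assms by simp
      have "\<bar>b - c\<bar> \<le> a" using assms by (simp add: abs_le_iff)
      then have "(b - c)\<^sup>2 \<le> a\<^sup>2" by (metis abs_le_square_iff abs_of_nonneg assms(1))
      moreover have "a\<^sup>2 \<le> (b + c)\<^sup>2" using assms by (intro power_mono) auto
      ultimately have "2 * c * x \<le> 2 * c * b" "2 * c * (- b) \<le> 2 * c * x"
        unfolding * by (simp_all add: power2_eq_square algebra_simps)
      then have "x \<le> b" "- b \<le> x" using c by (simp_all only: mult_le_cancel_left_pos)
      then show ?thesis by simp
    qed
    then show "x\<^sup>2 \<le> b\<^sup>2" using assms by (simp add: abs_le_square_iff[symmetric])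
  qed
  define y where "y = sqrt (b\<^sup>2 - x\<^sup>2)"
  have y: "y\<^sup>2 = b\<^sup>2 - x\<^sup>2" using x by (simp add: y_def)
  have d2: "dist (vector [u, v] :: real^2) (vector [u', v']) = sqrt ((u - u')\<^sup>2 + (v - v')\<^sup>2)" for u v u' v'
    by (simp add: dist_norm norm_vec_def L2_set_def sum_2)
  show ?thesis
  proof (rule that[of "vector [0, 0]" "vector [c, 0]" "vector [x, y]"])
    show "dist (vector [0, 0] :: real^2) (vector [c, 0]) = c" using assms by (simp add: d2)
    have "(c - x)\<^sup>2 + (0 - y)\<^sup>2 = a\<^sup>2"
      using x(2) y by (simp add: power2_diff algebra_simps)
    then show "dist (vector [c, 0] :: real^2) (vector [x, y]) = a" unfolding d2 using assms by simp
    have "(x - 0)\<^sup>2 + (y - 0)\<^sup>2 = b\<^sup>2" using y by simp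
    then show "dist (vector [x, y] :: real^2) (vector [0, 0]) = b" unfolding d2 using assms by simp
  qed
qed

context Metric_space
begin

lemma comparison_triangle_exists:
  assumes "p \<in> M" "q \<in> M" "r \<in> M"
  obtains p' q' r' where "comparison_triangle d p q r p' q' r'"
  using euclidean_triangle_exists[of "d q r" "d r p" "d p q"]
    triangle[of q p r] triangle[of r q p] triangle[of p r q] assms
  unfolding comparison_triangle_def by (simp add: commute add.commute) metis

lemma geodesic_between_reverse:
  assumes "geodesic_between M d x y \<xi>"
  shows "geodesic_between M d y x (\<lambda>t. \<xi> (d x y - t))"
  unfolding geodesic_between_def
proof (intro conjI ballI)
  have sub: "d x y - s \<in> {0..d x y}" if "s \<in> {0..d y x}" for s
    using that commute[of y x] by auto
  show "(\<lambda>t. \<xi> (d x y - t)) ` {0..d y x} \<subseteq> M"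
    using assms sub unfolding geodesic_between_def by blast
  show "d (\<xi> (d x y - s)) (\<xi> (d x y - t)) = \<bar>s - t\<bar>" if "s \<in> {0..d y x}" "t \<in> {0..d y x}" for s t
    using assms sub[OF that(1)] sub[OF that(2)] unfolding geodesic_between_def by simp
  show "\<xi> (d x y - 0) = y" "\<xi> (d x y - d y x) = x"
    using assms commute[of y x] unfolding geodesic_between_def by auto
qed

lemma CAT0_inequality:
  assumes "CAT0_space M d" "geodesic_triangle M d p q r \<alpha> \<beta> \<gamma>" "comparison_triangle d p q r p' q' r'"
    "side_corresponds d p q \<alpha> p' q' x x'" "side_corresponds d r p \<gamma> r' p' y y'"
  shows "d x y \<le> dist x' y'"
proof -
  have "triangle_corresponds d p q r \<alpha> \<beta> \<gamma> p' q' r' x x'" "triangle_corresponds d p q r \<alpha> \<beta> \<gamma> p' q' r' y y'"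
    using assms(4,5) unfolding triangle_corresponds_def by blast+
  then show ?thesis
    using assms(1)[unfolded CAT0_space_def] assms(2,3) by blast
qed

lemma CAT0_geodesic_exists:
  assumes "CAT0_space M d" "x \<in> M" "y \<in> M"
  obtains \<xi> where "geodesic_between M d x y \<xi>"
  using assms unfolding CAT0_space_def geodesic_space_def by blast

text \<open>In the comparison triangle the two points at ratio t from p' are the images of q' and r'
  under the homothety with center p' and factor t.\<close>

lemma CAT0_convex:
  assumes cat: "CAT0_space M d" and M: "p \<in> M" "q \<in> M" "r \<in> M"
    and \<alpha>: "geodesic_between M d p q \<alpha>" and \<gamma>: "geodesic_between M d p r \<gamma>" and t: "t \<in> {0..1}"
  shows "d (\<alpha> (t * d p q)) (\<gamma> (t * d p r)) \<le> t * d q r"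
proof -
  obtain \<beta> where \<beta>: "geodesic_between M d q r \<beta>" by (rule CAT0_geodesic_exists[OF cat M(2,3)])
  obtain p' q' r' where cmp: "comparison_triangle d p q r p' q' r'"
    by (rule comparison_triangle_exists[OF M])
  define x' where "x' = p' + t *\<^sub>R (q' - p')"
  define y' where "y' = p' + t *\<^sub>R (r' - p')"
  have dists: "dist p' q' = d p q" "dist q' r' = d q r" "dist r' p' = d r p"
    using cmp by (auto simp: comparison_triangle_def)
  have scaled: "norm (t *\<^sub>R v) = t * norm v" "norm ((1 - t) *\<^sub>R v) = (1 - t) * norm v" for v :: "real^2"
    using t by simp_all
  have tri: "geodesic_triangle M d p q r \<alpha> \<beta> (\<lambda>s. \<gamma> (d p r - s))"
    unfolding geodesic_triangle_def using M \<alpha> \<beta> geodesic_between_reverse[OF \<gamma>] by blast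
  have 1: "side_corresponds d p q \<alpha> p' q' (\<alpha> (t * d p q)) x'"
    unfolding side_corresponds_def
  proof (intro bexI[of _ "t * d p q"] conjI refl)
    show "x' \<in> closed_segment p' q'"
      unfolding closed_segment_def x'_def using t
      by (auto intro!: exI[of _ t] simp: algebra_simps)
    have "norm (p' - x') = norm (t *\<^sub>R (p' - q'))" by (simp add: x'_def norm_minus_commute algebra_simps)
    then show "dist p' x' = t * d p q" using scaled(1) dists(1) by (simp only: dist_norm)
    show "t * d p q \<in> {0..d p q}" using t by (simp add: mult_left_le_one_le)
  qed
  have 2: "side_corresponds d r p (\<lambda>s. \<gamma> (d p r - s)) r' p' (\<gamma> (t * d p r)) y'"
    unfolding side_corresponds_def
  \<comment> \<open>The third side of a triangle runs from r to p, so parameters on it are counted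
    from r.\<close>
  proof (intro bexI[of _ "(1 - t) * d r p"] conjI)
    show "\<gamma> (t * d p r) = \<gamma> (d p r - (1 - t) * d r p)"
      by (simp add: commute[of r p] algebra_simps)
    show "y' \<in> closed_segment r' p'"
      unfolding closed_segment_def y'_def using t
      by (auto intro!: exI[of _ "1 - t"] simp: algebra_simps)
    have "r' - y' = (1 - t) *\<^sub>R (r' - p')" by (simp add: y'_def algebra_simps)
    then show "dist r' y' = (1 - t) * d r p" using scaled(2) dists(3) by (simp only: dist_norm)
    show "(1 - t) * d r p \<in> {0..d r p}" using t by (simp add: mult_left_le_one_le)
  qed
  have "d (\<alpha> (t * d p q)) (\<gamma> (t * d p r)) \<le> dist x' y'"
    by (rule CAT0_inequality[OF cat tri cmp 1 2])
  also have "x' - y' = t *\<^sub>R (q' - r')" by (simp add: x'_def y'_def algebra_simps)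
  then have "dist x' y' = t * d q r" using scaled(1) dists(2) by (simp only: dist_norm)
  finally show ?thesis .
qed

text \<open>The comparison triangle of x, w, y is degenerate: q' lies on the segment from r' to p'
  and corresponds both to w and to the point of \<open>\<xi>\<close>, so their distance is at most
  0.\<close>

lemma CAT0_geodesic_unique:
  assumes cat: "CAT0_space M d" and M: "x \<in> M" "w \<in> M" "y \<in> M"
    and \<xi>: "geodesic_between M d x y \<xi>" and t: "t \<in> {0..1}"
    and w: "d x w = t * d x y" "d w y = (1 - t) * d x y"
  shows "w = \<xi> (t * d x y)"
proof -
  obtain \<alpha> \<beta> where \<alpha>: "geodesic_between M d x w \<alpha>" and \<beta>: "geodesic_between M d w y \<beta>"
    using CAT0_geodesic_exists[OF cat] M by metis
  obtain p' q' r' where cmp: "comparison_triangle d x w y p' q' r'"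
    by (rule comparison_triangle_exists[OF M])
  have dists: "dist p' q' = d x w" "dist q' r' = d w y" "dist r' p' = d y x"
    using cmp by (auto simp: comparison_triangle_def)
  have tri: "geodesic_triangle M d x w y \<alpha> \<beta> (\<lambda>s. \<xi> (d x y - s))"
    unfolding geodesic_triangle_def using M \<alpha> \<beta> geodesic_between_reverse[OF \<xi>] by blast
  have 1: "side_corresponds d x w \<alpha> p' q' w q'"
    unfolding side_corresponds_def
    using \<alpha> dists(1) by (intro bexI[of _ "d x w"]) (auto simp: geodesic_between_def)
  have 2: "side_corresponds d y x (\<lambda>s. \<xi> (d x y - s)) r' p' (\<xi> (t * d x y)) q'"
    unfolding side_corresponds_def
  proof (intro bexI[of _ "(1 - t) * d y x"] conjI)
    show "\<xi> (t * d x y) = \<xi> (d x y - (1 - t) * d y x)"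
      by (simp add: commute[of y x] algebra_simps)
    have "dist r' p' = dist r' q' + dist q' p'"
      using dists w by (simp add: dist_commute commute[of y x] algebra_simps)
    then show "q' \<in> closed_segment r' p'" by (simp add: between flip: between_mem_segment)
    show "dist r' q' = (1 - t) * d y x"
      using dists(2) w(2) by (simp add: dist_commute commute[of y x])
    show "(1 - t) * d y x \<in> {0..d y x}" using t by (simp add: mult_left_le_one_le)
  qed
  have "d w (\<xi> (t * d x y)) \<le> dist q' q'"
    by (rule CAT0_inequality[OF cat tri cmp 1 2])
  moreover have "t * d x y \<in> {0..d x y}" using t by (simp add: mult_left_le_one_le)
  then have "\<xi> (t * d x y) \<in> M" using \<xi> unfolding geodesic_between_def by blast
  ultimately show ?thesis using M(2) nonneg[of w "\<xi> (t * d x y)"] by simp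
qed

end

section \<open>Transfer between the space and the plane\<close>

lemma asdim_le_isometry:
  assumes "Metric_space M d" "Metric_space M' d'"
    and \<phi>: "\<phi> ` M = M'" and iso: "\<And>x y. \<lbrakk>x \<in> M; y \<in> M\<rbrakk> \<Longrightarrow> d' (\<phi> x) (\<phi> y) = d x y"
    and asdim: "asdim_le M d n"
  shows "asdim_le M' d' n"
proof (rule Metric_space.asdim_leI[OF assms(2)])
  fix r :: real assume r: "r > 0"
  interpret M: Metric_space M d by fact
  interpret M': Metric_space M' d' by fact
  obtain T B where T: "M \<subseteq> (\<Union>k\<in>{0..n}. T k)" "\<And>k. k \<in> {0..n} \<Longrightarrow> T k \<subseteq> M"
    "\<And>k. k \<in> {0..n} \<Longrightarrow> chain_bounded d r B (T k)"
    by (rule M.asdim_leD[OF asdim r]) (rule that)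
  have "inj_on \<phi> M"
  proof (rule inj_onI)
    fix x y assume xy: "x \<in> M" "y \<in> M" "\<phi> x = \<phi> y"
    then have "d x y = d' (\<phi> x) (\<phi> x)" using iso[of x y] by simp
    also have "\<dots> = 0" using \<phi> xy(1) by (intro M'.mdist_zero) blast
    finally show "x = y" using xy by simp
  qed
  define g where "g = inv_into M \<phi>"
  have g: "g (\<phi> x) = x" if "x \<in> M" for x
    unfolding g_def using \<open>inj_on \<phi> M\<close> that by (rule inv_into_f_f)
  have "chain_bounded d' r B (\<phi> ` T k)" if k: "k \<in> {0..n}" for k
    unfolding chain_bounded_def
  proof (intro ballI allI impI)
    fix x y assume x: "x \<in> \<phi> ` T k" and xy: "(x, y) \<in> (chain_rel d' r (\<phi> ` T k))\<^sup>*"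
    have gT: "g u \<in> T k \<and> u = \<phi> (g u) \<and> g u \<in> M" if "u \<in> \<phi> ` T k" for u
      using that g T(2)[OF k] by auto
    have y: "y \<in> \<phi> ` T k" using chain_rtrancl_in[OF xy x] .
    have dg: "d (g u) (g v) = d' u v" if "u \<in> \<phi> ` T k" "v \<in> \<phi> ` T k" for u v
      using iso[of "g u" "g v"] gT[OF that(1)] gT[OF that(2)] by simp
    have "(g x, g y) \<in> (chain_rel d r (T k))\<^sup>*"
      by (rule chain_rtrancl_map[OF xy]) (use gT dg in auto)
    then have "d (g x) (g y) \<le> B" using T(3)[OF k] gT[OF x] unfolding chain_bounded_def by blast
    then show "d' x y \<le> B" using dg[OF x y] by simp
  qed
  moreover have "M' \<subseteq> (\<Union>k\<in>{0..n}. \<phi> ` T k)" using \<phi> T(1) by blast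
  moreover have "\<phi> ` T k \<subseteq> M'" if "k \<in> {0..n}" for k using \<phi> T(2)[OF that] by blast
  ultimately show "\<exists>T B. M' \<subseteq> (\<Union>k\<in>{0..n}. T k) \<and>
      (\<forall>k\<in>{0..n}. T k \<subseteq> M' \<and> chain_bounded d' r B (T k))"
    by (intro exI[of _ "\<lambda>k. \<phi> ` T k"] exI[of _ B] conjI ballI)
qed

text \<open>The metric is pulled back along the homeomorphism, composed with a linear isomorphism
  onto \<open>complex\<close>. The homeomorphism gives \<open>open_iff\<close>, properness gives
  \<open>compact_ball\<close>, and the comparison lemmas give \<open>G_convex\<close> and
  \<open>G_unique\<close>.\<close>

lemma CAT0_plane_coordinates:
  assumes "Metric_space X d" and proper: "proper_metric_space X d" and cat: "CAT0_space X d"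
    and homeo: "Metric_space.mtopology X d homeomorphic_space (euclidean :: (real^2) topology)"
  obtains h :: "complex \<Rightarrow> 'a" and G where "range h = X" "busemann_plane (\<lambda>u v. d (h u) (h v)) G"
proof -
  interpret Metric_space X d by fact
  obtain \<iota> :: "real^2 \<Rightarrow> complex" and \<kappa> where \<iota>: "linear \<iota>" "linear \<kappa>" "\<And>x. \<kappa> (\<iota> x) = x" "\<And>x. \<iota> (\<kappa> x) = x"
    by (rule isomorphisms_UNIV_UNIV[where 'M = "real^2" and 'N = complex]) auto
  have "homeomorphic_maps euclidean euclidean \<iota> \<kappa>"
    unfolding homeomorphic_maps_def using \<iota> by (auto intro: linear_continuous_on simp: linear_conv_bounded_linear)
  then have "(euclidean :: (real^2) topology) homeomorphic_space (euclidean :: complex topology)"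
    unfolding homeomorphic_space_def by blast
  with homeo have "mtopology homeomorphic_space (euclidean :: complex topology)"
    by (rule homeomorphic_space_trans)
  then obtain f h where fh: "homeomorphic_maps mtopology (euclidean :: complex topology) f h"
    unfolding homeomorphic_space_def by blast
  then have contf: "continuous_map mtopology euclidean f" and conth: "continuous_map euclidean mtopology h"
    and hf: "\<And>x. x \<in> X \<Longrightarrow> h (f x) = x" and fh: "\<And>z. f (h z) = z"
    unfolding homeomorphic_maps_def by auto
  have hX: "h z \<in> X" for z using conth by (auto simp: continuous_map_def)
  have range_h: "range h = X"
  proof
    show "range h \<subseteq> X" using hX by blast
    show "X \<subseteq> range h" using hf by (metis rangeI subsetI)
  qed
  have inj_h: "inj h" using fh by (rule inj_on_inverseI)
  have "\<forall>u v. \<exists>\<xi>. geodesic_between X d (h u) (h v) \<xi>"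
    using cat hX unfolding CAT0_space_def geodesic_space_def by blast
  then obtain \<xi> where \<xi>: "\<And>u v. geodesic_between X d (h u) (h v) (\<xi> u v)" by metis
  define D where "D = (\<lambda>u v. d (h u) (h v))"
  define G where "G u v t = f (\<xi> u v (t * D u v))" for u v t
  have tD: "t * D u v \<in> {0..D u v}" if "t \<in> {0..1}" for t u v
    using that by (simp add: D_def mult_left_le_one_le)
  have hG: "h (G u v t) = \<xi> u v (t * D u v)" if "t \<in> {0..1}" for t u v
  proof -
    have "\<xi> u v (t * D u v) \<in> X"
      using \<xi>[of u v] tD[OF that, of u v] unfolding geodesic_between_def D_def by blast
    then show ?thesis using hf by (simp add: G_def)
  qed
  have "busemann_plane D G"
  proof
    fix x y z w :: complex and s t b :: real
    show "0 \<le> D x y" by (simp add: D_def)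
    show "D x y = 0 \<longleftrightarrow> x = y" using hX fh by (metis D_def zero)
    show "D x y = D y x" by (simp add: D_def commute)
    show "D x z \<le> D x y + D y z" unfolding D_def by (intro triangle hX)
    show "open S \<longleftrightarrow> (\<forall>x\<in>S. \<exists>e>0. \<forall>y. D x y < e \<longrightarrow> y \<in> S)" for S
    proof -
      have eqS: "{x \<in> topspace mtopology. f x \<in> S} = h ` S"
      proof
        show "{x \<in> topspace mtopology. f x \<in> S} \<subseteq> h ` S"
          using hf by (metis (mono_tags, lifting) imageI mem_Collect_eq subsetI topspace_mtopology)
        show "h ` S \<subseteq> {x \<in> topspace mtopology. f x \<in> S}" using fh hX by auto
      qed
      have "open S \<longleftrightarrow> openin mtopology (h ` S)"
      proof
        assume "open S"
        then show "openin mtopology (h ` S)"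
          using openin_continuous_map_preimage[OF contf, of S] eqS by simp
      next
        assume "openin mtopology (h ` S)"
        then have "open {z. h z \<in> h ` S}"
          using openin_continuous_map_preimage[OF conth, of "h ` S"] by simp
        then show "open S" by (simp only: inj_image_mem_iff[OF inj_h] Collect_mem_eq)
      qed
      also have "\<dots> \<longleftrightarrow> (\<forall>x\<in>S. \<exists>e>0. mball (h x) e \<subseteq> h ` S)"
        unfolding openin_mtopology using hX by blast
      also have "\<dots> \<longleftrightarrow> (\<forall>x\<in>S. \<exists>e>0. \<forall>y. D x y < e \<longrightarrow> y \<in> S)"
      proof -
        have "mball (h x) e \<subseteq> h ` S \<longleftrightarrow> (\<forall>y. D x y < e \<longrightarrow> y \<in> S)" for x e
        proof
          assume L: "mball (h x) e \<subseteq> h ` S"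
          show "\<forall>y. D x y < e \<longrightarrow> y \<in> S"
          proof (intro allI impI)
            fix y assume "D x y < e"
            then have "h y \<in> h ` S" using L hX by (auto simp: D_def)
            then show "y \<in> S" by (simp only: inj_image_mem_iff[OF inj_h])
          qed
        next
          assume R: "\<forall>y. D x y < e \<longrightarrow> y \<in> S"
          show "mball (h x) e \<subseteq> h ` S"
          proof
            fix p assume "p \<in> mball (h x) e"
            then have p: "p \<in> X" "d (h x) p < e" by auto
            then have "f p \<in> S" using R hf[OF p(1)] by (simp add: D_def)
            then show "p \<in> h ` S" using hf[OF p(1)] by (metis image_eqI)
          qed
        qed
        then show ?thesis by simp
      qed
      finally show ?thesis .
    qed
    show "compact {y. D x y \<le> b}"
    proof -
      have "closedin mtopology (mcball (h x) b)" "mbounded (mcball (h x) b)"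
        by (simp_all add: closedin_mcball mbounded_mcball)
      then have "compactin mtopology (mcball (h x) b)"
        using proper unfolding proper_metric_space_def by blast
      then have "compact (f ` mcball (h x) b)"
        using image_compactin[OF _ contf] by simp
      moreover have "f ` mcball (h x) b = {y. D x y \<le> b}"
      proof
        show "f ` mcball (h x) b \<subseteq> {y. D x y \<le> b}" using hf by (auto simp: D_def)
        show "{y. D x y \<le> b} \<subseteq> f ` mcball (h x) b"
        proof
          fix y assume "y \<in> {y. D x y \<le> b}"
          then have "h y \<in> mcball (h x) b" using hX by (simp add: D_def)
          then have "f (h y) \<in> f ` mcball (h x) b" by (rule imageI)
          then show "y \<in> f ` mcball (h x) b" by (simp only: fh)
        qed
      qed
      ultimately show ?thesis by simp
    qed
    show "G x y 0 = x" "G x y 1 = y"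
      using \<xi>[of x y] fh unfolding geodesic_between_def G_def D_def by auto
    show "D (G x y s) (G x y t) = \<bar>s - t\<bar> * D x y" if st: "s \<in> {0..1}" "t \<in> {0..1}"
    proof -
      have "D (G x y s) (G x y t) = d (\<xi> x y (s * D x y)) (\<xi> x y (t * D x y))"
        by (simp add: D_def hG[OF st(1), unfolded D_def] hG[OF st(2), unfolded D_def])
      also have "\<dots> = \<bar>s * D x y - t * D x y\<bar>"
        using \<xi>[of x y] tD[OF st(1), of x y] tD[OF st(2), of x y]
        unfolding geodesic_between_def D_def by blast
      also have "\<dots> = \<bar>s - t\<bar> * D x y"
        by (simp add: D_def abs_mult flip: left_diff_distrib)
      finally show ?thesis .
    qed
    show "D (G x y t) (G x z t) \<le> t * D y z" if t: "t \<in> {0..1}"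
      using CAT0_convex[OF cat hX hX hX \<xi>[of x y] \<xi>[of x z] t] hG[OF t, of x y] hG[OF t, of x z]
      by (simp add: D_def)
    show "w = G x y t" if t: "t \<in> {0..1}" and w: "D x w = t * D x y" "D w y = (1 - t) * D x y"
    proof -
      have "h w = \<xi> x y (t * d (h x) (h y))"
        by (rule CAT0_geodesic_unique[OF cat hX hX hX \<xi> t]) (use w in \<open>simp_all add: D_def\<close>)
      then have "f (h w) = G x y t" by (simp add: G_def D_def)
      then show ?thesis by (simp add: fh)
    qed
  qed
  then show ?thesis using that range_h unfolding D_def by blast
qed

theorem theorem1p2:
  fixes X :: "'a set" and d :: "'a \<Rightarrow> 'a \<Rightarrow> real"
  assumes "Metric_space X d"
    and "proper_metric_space X d"
    and "CAT0_space X d"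
    and "Metric_space.mtopology X d homeomorphic_space (euclidean :: (real^2) topology)"
  shows "asdim_eq X d 2"
proof -
  interpret Metric_space X d by fact
  obtain h :: "complex \<Rightarrow> 'a" and G where h: "range h = X"
    and plane: "busemann_plane (\<lambda>u v. d (h u) (h v)) G"
    by (rule CAT0_plane_coordinates[OF assms])
  interpret plane: busemann_plane "\<lambda>u v. d (h u) (h v)" G by (rule plane)
  have "asdim_le X d 2"
    by (rule asdim_le_isometry[OF plane.metric.Metric_space_axioms assms(1) h refl plane.asdim_le_2])
  moreover have "\<not> asdim_le X d (2 - 1)"
  proof
    assume asdim: "asdim_le X d (2 - 1)"
    define f where "f = inv_into UNIV h"
    have hf: "h (f x) = x" if "x \<in> X" for x
      unfolding f_def using that h by (simp add: f_inv_into_f)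
    have "f (h z) = z" for z
      using plane.zero[of "f (h z)" z] hf[of "h z"] h by (metis mdist_zero rangeI)
    then have f: "f ` X = UNIV" using h by (metis image_image range_eqI UNIV_eq_I)
    have "asdim_le UNIV (\<lambda>u v. d (h u) (h v)) (2 - 1)"
      by (rule asdim_le_isometry[OF assms(1) plane.metric.Metric_space_axioms f _ asdim]) (simp add: hf)
    then show False using plane.not_asdim_le_1 by simp
  qed
  ultimately show ?thesis unfolding asdim_eq_def by blast
qed

end
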